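(* Let $m\ge2$, $t_{-1}<0=t_0<t_1<\dots<t_{m+5}<t_{m+6}$, $d_k=t_k-t_{k-1}$, $\mu=\{t_0,\dots,t_{m+5}\}$, and let $\mathbf z(t)=\sum_{i=0}^{m+2}\mathbf z_iN^2_{i,\mu}(t)$, $\mathbf z_i\in\mathbb C$; put $\mathbf z_{-1}=\mathbf z_{m+3}=0$. Let $\nu=\{s_i\}=\{\langle t_0\rangle^3<\dots<\langle t_{m+5}\rangle^3\}$ and $\rho=\{t_{-1}<\langle t_0\rangle^3<\dots<\langle t_{m+5}\rangle^3<t_{m+6}\}$. Then $\mathbf z^2(t)=\sum_{k=0}^{3m+12}\mathbf p_kN^4_{k,\nu}(t)$ with $$\mathbf p_0=\mathbf p_1=\mathbf p_{3m+11}=\mathbf p_{3m+12}=0,\quad \mathbf p_2=\tfrac{d_1}{d_1+d_2}\mathbf z_0^2,\quad \mathbf p_{3m+10}=\tfrac{d_{m+5}}{d_{m+4}+d_{m+5}}\mathbf z_{m+2}^2,$$ $$\mathbf p_{3k}=\tfrac23\mathbf z_{k-1}^2+\tfrac13\Big(\tfrac{d_{k+1}\mathbf z_{k-2}+d_k\mathbf z_{k-1}}{d_k+d_{k+1}}\Big)\Big(\tfrac{d_{k+2}\mathbf z_{k-1}+d_{k+1}\mathbf z_k}{d_{k+1}+d_{k+2}}\Big)\ (1\le k\le m+3),$$ $$\mathbf p_{3k+1}=\mathbf z_{k-1}\tfrac{d_{k+2}\mathbf z_{k-1}+d_{k+1}\mathbf z_k}{d_{k+1}+d_{k+2}},\quad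 \mathbf p_{3k+2}=\mathbf z_k\tfrac{d_{k+2}\mathbf z_{k-1}+d_{k+1}\mathbf z_k}{d_{k+1}+d_{k+2}}\ (1\le k\le m+2).$$ Suppose that $d_{m+3}=d_2$, $d_{m+4}=d_3$ and that $\mathbf z_0,\dots,\mathbf z_{m+2}$ satisfy $\sum_{j=6-k}^{3m+8-k}(s_{j+5}-s_j)\mathbf p_j=0$ for $k=0,1,2$. Then the closed quintic Pythagorean-Hodograph B-spline curve $\mathbf r(t)$, $t\in[t_2,t_{m+3}]$, with $\mathbf r'=\mathbf z^2$ is $\mathbf r(t)=\sum_{i=0}^{3m+13}\mathbf r_iN^5_{i,\rho}(t)$ with $\mathbf r_0$ arbitrary and $$\mathbf r_2=\mathbf r_1=\mathbf r_0,\quad \mathbf r_3=\mathbf r_2+\tfrac{d_1}5\mathbf z_0^2,$$ $$\mathbf r_{3i+1}=\mathbf r_{3i}+\tfrac{d_{i+1}}5\Big(\tfrac23\mathbf z_{i-1}^2+\tfrac13\Big(\tfrac{d_{i+1}\mathbf z_{i-2}+d_i\mathbf z_{i-1}}{d_i+d_{i+1}}\Big)\Big(\tfrac{d_{i+2}\mathbf z_{i-1}+d_{i+1}\mathbf z_i}{d_{i+1}+d_{i+2}}\Big)\Big)\ (1\le i\le m+3),$$ $$\mathbf r_{3i+2}=\mathbf r_{3i+1}+\tfrac{\mathbf z_{i-1}}5(d_{i+2}\mathbf z_{i-1}+d_{i+1}\mathbf z_i),\quad \mathbf r_{3i+3}=\mathbf r_{3i+2}+\tfrac{\mathbf z_i}5(d_{i+2}\mathbf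 z_{i-1}+d_{i+1}\mathbf z_i)\ (1\le i\le m+2),$$ $$\mathbf r_{3m+11}=\mathbf r_{3m+10}+\tfrac{d_{m+5}}5\mathbf z_{m+2}^2,\quad \mathbf r_{3m+13}=\mathbf r_{3m+12}=\mathbf r_{3m+11},$$ and its total arc length is $$L=(l_{3m+7}-l_4)N^5_{4,\rho}(t_2)+(l_{3m+8}-l_5)N^5_{5,\rho}(t_2)+(l_{3m+9}-l_6)N^5_{6,\rho}(t_2),$$ where $l_2=l_1=l_0=0$, $l_3=l_2+\frac{d_1}5\mathbf z_0\bar{\mathbf z}_0$, $$l_{3i+1}=l_{3i}+\tfrac{2d_{i+1}}{15}\mathbf z_{i-1}\bar{\mathbf z}_{i-1}+\tfrac{d_{i+1}}{15(d_i+d_{i+1})(d_{i+1}+d_{i+2})}\Big(d_id_{i+2}\mathbf z_{i-1}\bar{\mathbf z}_{i-1}+\tfrac{d_{i+1}^2}2(\mathbf z_{i-2}\bar{\mathbf z}_i+\mathbf z_i\bar{\mathbf z}_{i-2})+\tfrac{d_{i+1}d_{i+2}}2(\mathbf z_{i-2}\bar{\mathbf z}_{i-1}+\mathbf z_{i-1}\bar{\mathbf z}_{i-2})+\tfrac{d_id_{i+1}}2(\mathbf z_{i-1}\bar{\mathbf z}_i+\mathbf z_i\bar{\mathbf z}_{i-1})\Big)$$ for $1\le i\le m+3$; for $1\le i\le m+2$, $l_{3i+2}=l_{3i+1}+\frac15\big(d_{i+2}\mathbf z_{i-1}\bar{\mathbf z}_{i-1}+\frac{d_{i+1}}2(\mathbf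 z_{i-1}\bar{\mathbf z}_i+\mathbf z_i\bar{\mathbf z}_{i-1})\big)$ and $l_{3i+3}=l_{3i+2}+\frac15\big(d_{i+1}\mathbf z_i\bar{\mathbf z}_i+\frac{d_{i+2}}2(\mathbf z_{i-1}\bar{\mathbf z}_i+\mathbf z_i\bar{\mathbf z}_{i-1})\big)$; $l_{3m+11}=l_{3m+10}+\frac{d_{m+5}}5\mathbf z_{m+2}\bar{\mathbf z}_{m+2}$; $l_{3m+13}=l_{3m+12}=l_{3m+11}$.
   Context: Normalized B-splines: for a nondecreasing knot sequence $\mu=\{t_i\}$, $N^0_{i,\mu}(t)=1$ if $t\in[t_i,t_{i+1})$ and $0$ otherwise, and $N^n_{i,\mu}(t)=\frac{t-t_i}{t_{i+n}-t_i}N^{n-1}_{i,\mu}(t)+\frac{t_{i+n+1}-t}{t_{i+n+1}-t_{i+1}}N^{n-1}_{i+1,\mu}(t)$ with $0/0=0$. Basis functions and the knots $s_i$ are indexed starting at $0$. $\langle t\rangle^k$ denotes the knot $t$ repeated $k$ times. Points of $\mathbb R^2$ are identified with complex numbers. Closed means $\mathbf r(t_2)=\mathbf r(t_{m+3})$. *)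

theory Defs
  imports "HOL-Analysis.Analysis"
begin

text \<open>All indices are integers, so that the index \<open>-1\<close> and differences of indices can be written
  as they stand. Only finitely many values of a knot sequence or of a sequence of control points
  are meaningful; the B-splines used below refer to no other values.\<close>

text \<open>Normalized B-splines. The convention \<open>0/0 = 0\<close> is the one of HOL, where \<open>x / 0 = 0\<close>.\<close>

fun bspline :: "(int \<Rightarrow> real) \<Rightarrow> nat \<Rightarrow> int \<Rightarrow> real \<Rightarrow> real" where
  "bspline \<mu> 0 i x = (if \<mu> i \<le> x \<and> x < \<mu> (i + 1) then 1 else 0)"
| "bspline \<mu> (Suc n) i x =
     (x - \<mu> i) / (\<mu> (i + int (Suc n)) - \<mu> i) * bspline \<mu> n i x
   + (\<mu> (i + int (Suc n) + 1) - x) / (\<mu> (i + int (Suc n) + 1) - \<mu> (i + 1)) * bspline \<mu> n (i + 1) x"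

text \<open>The spline of degree \<open>n\<close> with control points \<open>c 0, \<dots>, c b\<close>.\<close>

definition bspline_curve ::
    "(int \<Rightarrow> real) \<Rightarrow> nat \<Rightarrow> int \<Rightarrow> (int \<Rightarrow> complex) \<Rightarrow> real \<Rightarrow> complex" where
  "bspline_curve \<mu> n b c x = (\<Sum>i = 0..b. bspline \<mu> n i x *\<^sub>R c i)"

text \<open>For \<open>0 \<le> j \<le> 3 * m + 17\<close> these are the knots \<open>t 0, \<dots>, t (m + 5)\<close>, each repeated three times.\<close>

definition triple_knots :: "(int \<Rightarrow> real) \<Rightarrow> int \<Rightarrow> real" where
  "triple_knots t j = t (j div 3)"

definition extended_triple_knots :: "int \<Rightarrow> (int \<Rightarrow> real) \<Rightarrow> int \<Rightarrow> real" where
  "extended_triple_knots m t j =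
     (if j = 0 then t (- 1)
      else if j = 3 * m + 19 then t (m + 6)
      else triple_knots t (j - 1))"

definition knot_diff :: "(int \<Rightarrow> real) \<Rightarrow> int \<Rightarrow> real" where
  "knot_diff t k = t k - t (k - 1)"

text \<open>In the next three definitions \<open>d\<close> stands for the sequence of knot differences (coerced to
  the complex numbers) and \<open>z\<close> for the control points of the preimage.\<close>

definition square_control_points ::
    "int \<Rightarrow> (int \<Rightarrow> complex) \<Rightarrow> (int \<Rightarrow> complex) \<Rightarrow> (int \<Rightarrow> complex) \<Rightarrow> bool" where
  "square_control_points m d z p \<longleftrightarrow>
     p 0 = 0 \<and> p 1 = 0 \<and> p (3 * m + 11) = 0 \<and> p (3 * m + 12) = 0 \<and>
     p 2 = d 1 / (d 1 + d 2) * (z 0)\<^sup>2 \<and>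
     p (3 * m + 10) = d (m + 5) / (d (m + 4) + d (m + 5)) * (z (m + 2))\<^sup>2 \<and>
     (\<forall>k \<in> {1..m + 3}.
        p (3 * k) = 2 / 3 * (z (k - 1))\<^sup>2
          + 1 / 3 * ((d (k + 1) * z (k - 2) + d k * z (k - 1)) / (d k + d (k + 1)))
                  * ((d (k + 2) * z (k - 1) + d (k + 1) * z k) / (d (k + 1) + d (k + 2)))) \<and>
     (\<forall>k \<in> {1..m + 2}.
        p (3 * k + 1) =
          z (k - 1) * ((d (k + 2) * z (k - 1) + d (k + 1) * z k) / (d (k + 1) + d (k + 2))) \<and>
        p (3 * k + 2) =
          z k * ((d (k + 2) * z (k - 1) + d (k + 1) * z k) / (d (k + 1) + d (k + 2))))"

text \<open>There is no condition on \<open>r 0\<close>, which is arbitrary.\<close>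

definition ph_control_points ::
    "int \<Rightarrow> (int \<Rightarrow> complex) \<Rightarrow> (int \<Rightarrow> complex) \<Rightarrow> (int \<Rightarrow> complex) \<Rightarrow> bool" where
  "ph_control_points m d z r \<longleftrightarrow>
     r 2 = r 1 \<and> r 1 = r 0 \<and> r 3 = r 2 + d 1 / 5 * (z 0)\<^sup>2 \<and>
     (\<forall>i \<in> {1..m + 3}.
        r (3 * i + 1) = r (3 * i) + d (i + 1) / 5 *
          (2 / 3 * (z (i - 1))\<^sup>2
           + 1 / 3 * ((d (i + 1) * z (i - 2) + d i * z (i - 1)) / (d i + d (i + 1)))
                   * ((d (i + 2) * z (i - 1) + d (i + 1) * z i) / (d (i + 1) + d (i + 2))))) \<and>
     (\<forall>i \<in> {1..m + 2}.
        r (3 * i + 2) = r (3 * i + 1) + z (i - 1) / 5 * (d (i + 2) * z (i - 1) + d (i + 1) * z i) \<and>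
        r (3 * i + 3) = r (3 * i + 2) + z i / 5 * (d (i + 2) * z (i - 1) + d (i + 1) * z i)) \<and>
     r (3 * m + 11) = r (3 * m + 10) + d (m + 5) / 5 * (z (m + 2))\<^sup>2 \<and>
     r (3 * m + 13) = r (3 * m + 12) \<and> r (3 * m + 12) = r (3 * m + 11)"

definition arc_length_coeffs ::
    "int \<Rightarrow> (int \<Rightarrow> complex) \<Rightarrow> (int \<Rightarrow> complex) \<Rightarrow> (int \<Rightarrow> complex) \<Rightarrow> bool" where
  "arc_length_coeffs m d z l \<longleftrightarrow>
     l 2 = l 1 \<and> l 1 = l 0 \<and> l 0 = 0 \<and> l 3 = l 2 + d 1 / 5 * (z 0 * cnj (z 0)) \<and>
     (\<forall>i \<in> {1..m + 3}.
        l (3 * i + 1) = l (3 * i)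
          + 2 * d (i + 1) / 15 * (z (i - 1) * cnj (z (i - 1)))
          + d (i + 1) / (15 * (d i + d (i + 1)) * (d (i + 1) + d (i + 2))) *
            (d i * d (i + 2) * (z (i - 1) * cnj (z (i - 1)))
             + (d (i + 1))\<^sup>2 / 2 * (z (i - 2) * cnj (z i) + z i * cnj (z (i - 2)))
             + d (i + 1) * d (i + 2) / 2
                 * (z (i - 2) * cnj (z (i - 1)) + z (i - 1) * cnj (z (i - 2)))
             + d i * d (i + 1) / 2
                 * (z (i - 1) * cnj (z i) + z i * cnj (z (i - 1))))) \<and>
     (\<forall>i \<in> {1..m + 2}.
        l (3 * i + 2) = l (3 * i + 1) + 1 / 5 *
          (d (i + 2) * (z (i - 1) * cnj (z (i - 1)))
           + d (i + 1) / 2 * (z (i - 1) * cnj (z i) + z i * cnj (z (i - 1)))) \<and>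
        l (3 * i + 3) = l (3 * i + 2) + 1 / 5 *
          (d (i + 1) * (z i * cnj (z i))
           + d (i + 2) / 2 * (z (i - 1) * cnj (z i) + z i * cnj (z (i - 1))))) \<and>
     l (3 * m + 11) = l (3 * m + 10) + d (m + 5) / 5 * (z (m + 2) * cnj (z (m + 2))) \<and>
     l (3 * m + 13) = l (3 * m + 12) \<and> l (3 * m + 12) = l (3 * m + 11)"

text \<open>Arc length as the integral of the speed; \<open>has_integral\<close> includes integrability.\<close>

definition has_arc_length :: "(real \<Rightarrow> complex) \<Rightarrow> real \<Rightarrow> real \<Rightarrow> real \<Rightarrow> bool" where
  "has_arc_length r a b L \<longleftrightarrow>
     ((\<lambda>x. norm (vector_derivative r (at x within {a..b}))) has_integral L) {a..b}"

end

theory Submission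
  imports Defs
begin

text \<open>On a knot interval with neighbouring knots \<open>u < v < w < y\<close>, the splines of degree 2 over
  the simple knots and of degree 4 and 5 over the triple knots are explicit polynomials. Comparing
  coefficients there shows that the product of two quadratic splines with control points \<open>z\<close>
  and \<open>w\<close> is the quartic spline whose control points are a symmetric bilinear expression in
  \<open>z\<close> and \<open>w\<close>. A quintic spline whose control points have suitable multiples of these as
  differences is then an antiderivative of the product. Taking \<open>w = z\<close> gives the curve
  itself, and taking for \<open>w\<close> the complex conjugate of \<open>z\<close> gives its arc length. At
  \<open>t 2\<close> and at \<open>t (m + 3)\<close> only three quintic splines are nonzero, and the assumptions on
  \<open>d\<close> make their values there agree.\<close>

text \<open>A product of two C^1 piecewise quadratics is a C^1 piecewise quartic, and splines of
  degree 4 are C^1 exactly at knots of multiplicity 3; this dictates the triple knots. The bilinear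
  expression consists of Bezier coefficients. On \<open>[v, w]\<close> a quadratic spline has Bezier
  coefficients L, b, R, where L and R are its values at \<open>v\<close> and \<open>w\<close> and b
  is its middle control point. Multiplying it by a second spline with coefficients L', b', R' gives
  the quartic Bezier coefficients (L b' + b L') / 2, 2/3 b b' + (L R' + R L') / 6 and (b R' + R b')
  / 2 in the three inner positions. These are the control points with indices \<open>3k-1\<close>,
  \<open>3k\<close> and \<open>3k+1\<close>. The obstacle is the half-open support in degree 0: a
  formula on one knot interval says nothing about its right end. Continuity of the pieces is
  therefore checked at the knots, and differentiability there is glued from the two one-sided
  statements.\<close>

section \<open>Local support of B-splines\<close>

lemma bspline_eq_0:
  assumes "\<And>k. i \<le> k \<Longrightarrow> k \<le> i + int n \<Longrightarrow> bspline \<mu> 0 k x = 0"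
  shows "bspline \<mu> n i x = 0"
  using assms
proof (induction n arbitrary: i)
  case 0
  then show ?case by auto
next
  case (Suc n)
  have "bspline \<mu> n i x = 0" "bspline \<mu> n (i + 1) x = 0"
    using Suc.prems by (auto intro!: Suc.IH)
  then show ?case by simp
qed

text \<open>For \<open>j\<close> near the ends the window of \<open>n + 1\<close> indices sticks out
  of \<open>{0..b}\<close>. Demanding zero control points there gives the boundary intervals the
  same sum as the inner ones.\<close>

lemma bspline_curve_local:
  assumes zero: "\<And>k. 0 \<le> k \<Longrightarrow> k \<le> b + int n \<Longrightarrow> k \<noteq> j \<Longrightarrow> bspline \<mu> 0 k x = 0"
    and outside: "\<And>i. j - int n \<le> i \<Longrightarrow> i \<le> j \<Longrightarrow> i < 0 \<or> b < i \<Longrightarrow> c i = 0"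
  shows "bspline_curve \<mu> n b c x = (\<Sum>i = j - int n..j. bspline \<mu> n i x *\<^sub>R c i)"
  unfolding bspline_curve_def
proof (rule sum.mono_neutral_cong)
  fix i assume i: "i \<in> {0..b} - {j - int n..j}"
  have "bspline \<mu> n i x = 0"
    by (rule bspline_eq_0, rule zero) (use i in auto)
  then show "bspline \<mu> n i x *\<^sub>R c i = 0" by simp
qed (use outside in auto)

lemma bspline_curve_eq_0:
  assumes "\<And>k. 0 \<le> k \<Longrightarrow> k \<le> b + int n \<Longrightarrow> bspline \<mu> 0 k x = 0"
  shows "bspline_curve \<mu> n b c x = 0"
proof -
  have "bspline \<mu> n i x = 0" if "i \<in> {0..b}" for i
    by (rule bspline_eq_0, rule assms) (use that in auto)
  then show ?thesis by (simp add: bspline_curve_def)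
qed

lemma bspline_curve_cnj: "bspline_curve \<mu> n b (\<lambda>i. cnj (c i)) x = cnj (bspline_curve \<mu> n b c x)"
  by (simp add: bspline_curve_def)

section \<open>Explicit pieces on one knot interval\<close>

text \<open>Piece 0 belongs to the spline whose support ends at \<open>w\<close>, the last piece to
  the one whose support starts at \<open>v\<close>. Knots beyond \<open>u\<close> and
  \<open>y\<close> do not occur: on \<open>[v, w)\<close> they enter the recursion only next to a
  lower-degree spline that vanishes there.\<close>

definition quadratic_piece :: "real \<Rightarrow> real \<Rightarrow> real \<Rightarrow> real \<Rightarrow> nat \<Rightarrow> real \<Rightarrow> real" where
  "quadratic_piece u v w y i x =
    [(w - x)\<^sup>2 / ((w - u) * (w - v)),
     (x - u) * (w - x) / ((w - u) * (w - v)) + (y - x) * (x - v) / ((y - v) * (w - v)),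
     (x - v)\<^sup>2 / ((y - v) * (w - v))] ! i"

text \<open>Because \<open>v\<close> and \<open>w\<close> are triple, the middle piece is the middle
  Bernstein polynomial of degree 4 on \<open>[v, w]\<close>. The other four come from splines whose
  support reaches to \<open>u\<close> or \<open>y\<close>.\<close>

definition quartic_piece :: "real \<Rightarrow> real \<Rightarrow> real \<Rightarrow> real \<Rightarrow> nat \<Rightarrow> real \<Rightarrow> real" where
  "quartic_piece u v w y i x =
    [(w - x) ^ 4 / ((w - u) * (w - v) ^ 3),
     (x - u) * (w - x) ^ 3 / ((w - u) * (w - v) ^ 3) + 3 * (x - v) * (w - x) ^ 3 / (w - v) ^ 4,
     6 * (x - v)\<^sup>2 * (w - x)\<^sup>2 / (w - v) ^ 4,
     3 * (x - v) ^ 3 * (w - x) / (w - v) ^ 4 + (y - x) * (x - v) ^ 3 / ((y - v) * (w - v) ^ 3),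
     (x - v) ^ 4 / ((y - v) * (w - v) ^ 3)] ! i"

definition quintic_piece :: "real \<Rightarrow> real \<Rightarrow> real \<Rightarrow> real \<Rightarrow> nat \<Rightarrow> real \<Rightarrow> real" where
  "quintic_piece u v w y i x = (let Q = quartic_piece u v w y in
    [(w - x) / (w - u) * Q 0 x,
     (x - u) / (w - u) * Q 0 x + (w - x) / (w - u) * Q 1 x,
     (x - u) / (w - u) * Q 1 x + (w - x) / (w - v) * Q 2 x,
     (x - v) / (w - v) * Q 2 x + (y - x) / (y - v) * Q 3 x,
     (x - v) / (y - v) * Q 3 x + (y - x) / (y - v) * Q 4 x,
     (x - v) / (y - v) * Q 4 x] ! i)"

lemmas quadratic_pieces =
  quadratic_piece_def[of _ _ _ _ 0] quadratic_piece_def[of _ _ _ _ 1]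
  quadratic_piece_def[of _ _ _ _ "Suc 0"]
  quadratic_piece_def[of _ _ _ _ 2]
lemmas quartic_pieces =
  quartic_piece_def[of _ _ _ _ 0] quartic_piece_def[of _ _ _ _ 1]
  quartic_piece_def[of _ _ _ _ "Suc 0"]
  quartic_piece_def[of _ _ _ _ 2] quartic_piece_def[of _ _ _ _ 3] quartic_piece_def[of _ _ _ _ 4]
lemmas quintic_pieces =
  quintic_piece_def[of _ _ _ _ 0] quintic_piece_def[of _ _ _ _ 1]
  quintic_piece_def[of _ _ _ _ "Suc 0"]
  quintic_piece_def[of _ _ _ _ 2] quintic_piece_def[of _ _ _ _ 3] quintic_piece_def[of _ _ _ _ 4]
  quintic_piece_def[of _ _ _ _ 5]

text \<open>Here and in the next lemma, \<open>k\<close> is the index with \<open>\<mu> k \<le> x < \<mu> (k + 1)\<close>.\<close>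

lemma bspline_quadratic_pieces:
  assumes knots: "\<mu> (k - 1) = u" "\<mu> k = v" "\<mu> (k + 1) = w" "\<mu> (k + 2) = y"
    and one: "bspline \<mu> 0 k x = 1"
    and zero: "\<And>i. k - 2 \<le> i \<Longrightarrow> i \<le> k + 2 \<Longrightarrow> i \<noteq> k \<Longrightarrow> bspline \<mu> 0 i x = 0"
  shows "bspline \<mu> 2 (k - 2) x = quadratic_piece u v w y 0 x"
    "bspline \<mu> 2 (k - 1) x = quadratic_piece u v w y 1 x"
    "bspline \<mu> 2 k x = quadratic_piece u v w y 2 x"
proof -
  \<comment> \<open>Recentring the indices at \<open>k\<close> lets the recursion run between
    numerals, with the interval that contains \<open>x\<close> at index 0.\<close>
  define M where "M i = \<mu> (k + i)" for i
  have M: "M (-1) = u" "M 0 = v" "M 1 = w" "M 2 = y"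
    using knots by (simp_all add: M_def)
  define B where "B n i = bspline \<mu> n (k + i) x" for n i
  have rec: "B (Suc n) i =
     (x - M i) / (M (i + int n + 1) - M i) * B n i
     + (M (i + int n + 2) - x) / (M (i + int n + 2) - M (i + 1)) * B n (i + 1)" for n i
    by (simp add: B_def M_def algebra_simps)
  have B0: "B 0 0 = 1" using one by (simp add: B_def del: bspline.simps)
  have out: "B n i = 0" if "-2 \<le> i" "i + int n < 0 \<or> 0 < i" "i + int n \<le> 2" for n i
    unfolding B_def by (rule bspline_eq_0, rule zero) (use that in auto)
  have B1: "B 1 (-1) = (w - x) / (w - v)" "B 1 0 = (x - v) / (w - v)"
    using rec[of 0 "-1"] rec[of 0 0] by (simp_all add: M B0 out)
  have B2: "B 2 (-2) = quadratic_piece u v w y 0 x" "B 2 (-1) = quadratic_piece u v w y 1 x"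
      "B 2 0 = quadratic_piece u v w y 2 x"
    using rec[of 1 "-2"] rec[of 1 "-1"] rec[of 1 0]
    by (simp_all only: Suc_1 of_nat_1 quadratic_pieces)
      (simp_all add: M B1[simplified] out power2_eq_square)
  then show "bspline \<mu> 2 (k - 2) x = quadratic_piece u v w y 0 x"
    "bspline \<mu> 2 (k - 1) x = quadratic_piece u v w y 1 x"
    "bspline \<mu> 2 k x = quadratic_piece u v w y 2 x"
    by (simp_all add: B_def del: bspline.simps)
qed

lemma bspline_triple_pieces:
  assumes knots: "\<mu> (k - 4) = u" "\<mu> (k - 3) = u"
      "\<mu> (k - 2) = v" "\<mu> (k - 1) = v" "\<mu> k = v"
      "\<mu> (k + 1) = w" "\<mu> (k + 2) = w" "\<mu> (k + 3) = w"
      "\<mu> (k + 4) = y" "\<mu> (k + 5) = y"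
    and one: "bspline \<mu> 0 k x = 1"
    and zero: "\<And>i. k - 5 \<le> i \<Longrightarrow> i \<le> k + 5 \<Longrightarrow> i \<noteq> k \<Longrightarrow> bspline \<mu> 0 i x = 0"
  shows "bspline \<mu> 4 (k - 4) x = quartic_piece u v w y 0 x"
    "bspline \<mu> 4 (k - 3) x = quartic_piece u v w y 1 x"
    "bspline \<mu> 4 (k - 2) x = quartic_piece u v w y 2 x"
    "bspline \<mu> 4 (k - 1) x = quartic_piece u v w y 3 x"
    "bspline \<mu> 4 k x = quartic_piece u v w y 4 x"
    "bspline \<mu> 5 (k - 5) x = quintic_piece u v w y 0 x"
    "bspline \<mu> 5 (k - 4) x = quintic_piece u v w y 1 x"
    "bspline \<mu> 5 (k - 3) x = quintic_piece u v w y 2 x"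
    "bspline \<mu> 5 (k - 2) x = quintic_piece u v w y 3 x"
    "bspline \<mu> 5 (k - 1) x = quintic_piece u v w y 4 x"
    "bspline \<mu> 5 k x = quintic_piece u v w y 5 x"
proof -
  define M where "M i = \<mu> (k + i)" for i
  have M: "M (-4) = u" "M (-3) = u" "M (-2) = v" "M (-1) = v" "M 0 = v" "M 1 = w" "M 2 = w"
    "M 3 = w"
      "M 4 = y" "M 5 = y"
    using knots by (simp_all add: M_def)
  define B where "B n i = bspline \<mu> n (k + i) x" for n i
  have rec: "B (Suc n) i =
     (x - M i) / (M (i + int n + 1) - M i) * B n i
     + (M (i + int n + 2) - x) / (M (i + int n + 2) - M (i + 1)) * B n (i + 1)" for n i
    by (simp add: B_def M_def algebra_simps)
  have B0: "B 0 0 = 1" using one by (simp add: B_def del: bspline.simps)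
  have out: "B n i = 0" if "-5 \<le> i" "i + int n < 0 \<or> 0 < i" "i + int n \<le> 5" for n i
    unfolding B_def by (rule bspline_eq_0, rule zero) (use that in auto)
  have B1: "B 1 (-1) = (w - x) / (w - v)" "B 1 0 = (x - v) / (w - v)"
    using rec[of 0 "-1"] rec[of 0 0] by (simp_all add: M B0 out)
  have B2: "B 2 (-2) = (w - x)^2 / (w - v)^2" "B 2 (-1) = 2 * (x - v) * (w - x) / (w - v)^2"
      "B 2 0 = (x - v)^2 / (w - v)^2"
    using rec[of 1 "-2"] rec[of 1 "-1"] rec[of 1 0]
    by (simp_all only: Suc_1 of_nat_1)
      (simp_all add: M B1[simplified] out power2_eq_square)
  have n: "Suc 2 = 3" "Suc 3 = 4" "Suc 4 = 5" by auto
  \<comment> \<open>Up to degree 3 only the three copies of \<open>v\<close> and of \<open>w\<close>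
    are involved, which yields the Bernstein polynomials of \<open>[v, w]\<close>. The knots
    \<open>u\<close> and \<open>y\<close> enter with degree 4.\<close>
  have B3: "B 3 (-3) = (w - x)^3 / (w - v)^3" "B 3 (-2) = 3 * (x - v) * (w - x)^2 / (w - v)^3"
      "B 3 (-1) = 3 * (x - v)^2 * (w - x) / (w - v)^3" "B 3 0 = (x - v)^3 / (w - v)^3"
    using rec[of 2 "-3"] rec[of 2 "-2"] rec[of 2 "-1"] rec[of 2 0]
    by (simp_all only: n, simp_all add: M B2 out divide_inverse power2_eq_square power3_eq_cube
        inverse_mult_distrib, simp_all add: algebra_simps)
  have B4: "B 4 (-4) = quartic_piece u v w y 0 x" "B 4 (-3) = quartic_piece u v w y 1 x"
     "B 4 (-2) = quartic_piece u v w y 2 x" "B 4 (-1) = quartic_piece u v w y 3 x"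
     "B 4 0 = quartic_piece u v w y 4 x"
    using rec[of 3 "-4"] rec[of 3 "-3"] rec[of 3 "-2"] rec[of 3 "-1"] rec[of 3 0]
    by (simp_all only: n, simp_all add: quartic_pieces M B3 out divide_inverse power2_eq_square
        power3_eq_cube power4_eq_xxxx inverse_mult_distrib)
  have B5: "B 5 (-5) = quintic_piece u v w y 0 x" "B 5 (-4) = quintic_piece u v w y 1 x"
     "B 5 (-3) = quintic_piece u v w y 2 x" "B 5 (-2) = quintic_piece u v w y 3 x"
     "B 5 (-1) = quintic_piece u v w y 4 x" "B 5 0 = quintic_piece u v w y 5 x"
    using rec[of 4 "-5"] rec[of 4 "-4"] rec[of 4 "-3"] rec[of 4 "-2"] rec[of 4 "-1"] rec[of 4 0]
    by (simp_all only: n) (simp_all add: quintic_pieces M B4 out Let_def)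
  show "bspline \<mu> 4 (k - 4) x = quartic_piece u v w y 0 x"
    "bspline \<mu> 4 (k - 3) x = quartic_piece u v w y 1 x"
    "bspline \<mu> 4 (k - 2) x = quartic_piece u v w y 2 x"
    "bspline \<mu> 4 (k - 1) x = quartic_piece u v w y 3 x"
    "bspline \<mu> 4 k x = quartic_piece u v w y 4 x"
    "bspline \<mu> 5 (k - 5) x = quintic_piece u v w y 0 x"
    "bspline \<mu> 5 (k - 4) x = quintic_piece u v w y 1 x"
    "bspline \<mu> 5 (k - 3) x = quintic_piece u v w y 2 x"
    "bspline \<mu> 5 (k - 2) x = quintic_piece u v w y 3 x"
    "bspline \<mu> 5 (k - 1) x = quintic_piece u v w y 4 x"
    "bspline \<mu> 5 k x = quintic_piece u v w y 5 x"
    using B4 B5 by (simp_all add: B_def del: bspline.simps)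
qed

lemma quadratic_piece_left:
  assumes "u < v" "v < w" "w < y"
  shows "quadratic_piece u v w y 0 v = (w - v) / (w - u)"
    "quadratic_piece u v w y 1 v = (v - u) / (w - u)"
    "quadratic_piece u v w y 2 v = 0"
  using assms by (simp_all add: quadratic_pieces power2_eq_square)

lemma quadratic_piece_right:
  assumes "u < v" "v < w" "w < y"
  shows "quadratic_piece u v w y 0 w = 0" "quadratic_piece u v w y 1 w = (y - w) / (y - v)"
    "quadratic_piece u v w y 2 w = (w - v) / (y - v)"
  using assms by (simp_all add: quadratic_pieces power2_eq_square)

text \<open>Degree 5 at a triple knot leaves three nonzero splines. With a = (w - v) / (w - u) and b
  = (v - u) / (w - u) their values are the terms of (a + b)^2, where a + b = 1.\<close>

lemma quintic_piece_left:
  assumes "u < v" "v < w" "w < y"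
  shows "quintic_piece u v w y 0 v = (w - v)\<^sup>2 / (w - u)\<^sup>2"
    "quintic_piece u v w y 1 v = 2 * (w - v) * (v - u) / (w - u)\<^sup>2"
    "quintic_piece u v w y 2 v = (v - u)\<^sup>2 / (w - u)\<^sup>2" "quintic_piece u v w y 3 v = 0"
    "quintic_piece u v w y 4 v = 0" "quintic_piece u v w y 5 v = 0"
  using assms
  by (simp_all add: quintic_pieces quartic_pieces Let_def power2_eq_square power3_eq_cube
      power4_eq_xxxx divide_simps)

lemma quintic_piece_right:
  assumes "u < v" "v < w" "w < y"
  shows "quintic_piece u v w y 0 w = 0" "quintic_piece u v w y 1 w = 0"
    "quintic_piece u v w y 2 w = 0"
    "quintic_piece u v w y 3 w = (y - w)\<^sup>2 / (y - v)\<^sup>2"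
    "quintic_piece u v w y 4 w = 2 * (y - w) * (w - v) / (y - v)\<^sup>2"
    "quintic_piece u v w y 5 w = (w - v)\<^sup>2 / (y - v)\<^sup>2"
  using assms
  by (simp_all add: quintic_pieces quartic_pieces Let_def power2_eq_square power3_eq_cube
      power4_eq_xxxx divide_simps)

section \<open>Derivatives and products of the pieces\<close>

text \<open>The usual rule that the derivative of a B-spline is the degree times a difference of two
  lower-degree ones, each divided by the length of its support. The lengths occurring here are
  \<open>w - u\<close>, \<open>w - v\<close> and \<open>y - v\<close>; at the two outer pieces one
  of the two terms vanishes on the interval.\<close>

lemma quintic_piece_has_derivative:
  assumes "u < v" "v < w" "w < y"
  shows "(quintic_piece u v w y 0 has_real_derivative
      - 5 / (w - u) * quartic_piece u v w y 0 x) (at x)"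
   "(quintic_piece u v w y 1 has_real_derivative
      5 / (w - u) * quartic_piece u v w y 0 x - 5 / (w - u) * quartic_piece u v w y 1 x) (at x)"
   "(quintic_piece u v w y 2 has_real_derivative
      5 / (w - u) * quartic_piece u v w y 1 x - 5 / (w - v) * quartic_piece u v w y 2 x) (at x)"
   "(quintic_piece u v w y 3 has_real_derivative
      5 / (w - v) * quartic_piece u v w y 2 x - 5 / (y - v) * quartic_piece u v w y 3 x) (at x)"
   "(quintic_piece u v w y 4 has_real_derivative
      5 / (y - v) * quartic_piece u v w y 3 x - 5 / (y - v) * quartic_piece u v w y 4 x) (at x)"
   "(quintic_piece u v w y 5 has_real_derivative
      5 / (y - v) * quartic_piece u v w y 4 x) (at x)"
proof -
  \<comment> \<open>With the reciprocals as extra unknowns, tied to the knots by \<open>inv\<close>,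
    all sides become polynomials, and \<open>algebra\<close> can compare them modulo these
    relations.\<close>
  define \<alpha> \<beta> \<gamma> where "\<alpha> = inverse (w - v)" and "\<beta> = inverse (w - u)" and "\<gamma> = inverse (y - v)"
  have inv: "\<alpha> * (w - v) = 1" "\<beta> * (w - u) = 1" "\<gamma> * (y - v) = 1"
    using assms by (auto simp: \<alpha>_def \<beta>_def \<gamma>_def)
  have quartic: "quartic_piece u v w y 0 x = \<beta> * \<alpha> ^ 3 * (w - x) ^ 4"
    "quartic_piece u v w y 1 x = \<beta> * \<alpha> ^ 3 * ((x - u) * (w - x) ^ 3)
        + 3 * \<alpha> ^ 4 * ((x - v) * (w - x) ^ 3)"
    "quartic_piece u v w y 2 x = 6 * \<alpha> ^ 4 * ((x - v)\<^sup>2 * (w - x)\<^sup>2)"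
    "quartic_piece u v w y 3 x = 3 * \<alpha> ^ 4 * ((x - v) ^ 3 * (w - x))
        + \<gamma> * \<alpha> ^ 3 * ((y - x) * (x - v) ^ 3)"
    "quartic_piece u v w y 4 x = \<gamma> * \<alpha> ^ 3 * (x - v) ^ 4" for x
    by (simp_all add: quartic_pieces \<alpha>_def \<beta>_def \<gamma>_def divide_inverse power_inverse)
  have quintic: "quintic_piece u v w y 0 = (\<lambda>x. \<beta> * (w - x) * quartic_piece u v w y 0 x)"
    "quintic_piece u v w y 1
        = (\<lambda>x. \<beta> * (x - u) * quartic_piece u v w y 0 x + \<beta> * (w - x) * quartic_piece u v w y 1 x)"
    "quintic_piece u v w y 2
        = (\<lambda>x. \<beta> * (x - u) * quartic_piece u v w y 1 x + \<alpha> * (w - x) * quartic_piece u v w y 2 x)"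
    "quintic_piece u v w y 3
        = (\<lambda>x. \<alpha> * (x - v) * quartic_piece u v w y 2 x + \<gamma> * (y - x) * quartic_piece u v w y 3 x)"
    "quintic_piece u v w y 4
        = (\<lambda>x. \<gamma> * (x - v) * quartic_piece u v w y 3 x + \<gamma> * (y - x) * quartic_piece u v w y 4 x)"
    "quintic_piece u v w y 5 = (\<lambda>x. \<gamma> * (x - v) * quartic_piece u v w y 4 x)"
    by (simp_all add: fun_eq_iff quintic_pieces \<alpha>_def \<beta>_def \<gamma>_def divide_inverse Let_def)
  have div: "c / (w - v) = c * \<alpha>" "c / (w - u) = c * \<beta>" "c / (y - v) = c * \<gamma>" for c
    by (simp_all add: \<alpha>_def \<beta>_def \<gamma>_def divide_inverse)
  note D = derivative_eq_intros refl
  show "(quintic_piece u v w y 0 has_real_derivative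
      - 5 / (w - u) * quartic_piece u v w y 0 x) (at x)"
    unfolding quintic quartic div by (rule D)+ (simp, algebra)
  show "(quintic_piece u v w y 5 has_real_derivative
      5 / (y - v) * quartic_piece u v w y 4 x) (at x)"
    unfolding quintic quartic div by (rule D)+ (simp, algebra)
  show "(quintic_piece u v w y 1 has_real_derivative
      5 / (w - u) * quartic_piece u v w y 0 x - 5 / (w - u) * quartic_piece u v w y 1 x) (at x)"
    unfolding quintic quartic div by ((rule D)+, simp, insert inv, algebra)
  show "(quintic_piece u v w y 2 has_real_derivative
      5 / (w - u) * quartic_piece u v w y 1 x - 5 / (w - v) * quartic_piece u v w y 2 x) (at x)"
    unfolding quintic quartic div by ((rule D)+, simp, insert inv, algebra)
  show "(quintic_piece u v w y 3 has_real_derivative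
      5 / (w - v) * quartic_piece u v w y 2 x - 5 / (y - v) * quartic_piece u v w y 3 x) (at x)"
    unfolding quintic quartic div by ((rule D)+, simp, insert inv, algebra)
  show "(quintic_piece u v w y 4 has_real_derivative
      5 / (y - v) * quartic_piece u v w y 3 x - 5 / (y - v) * quartic_piece u v w y 4 x) (at x)"
    unfolding quintic quartic div by ((rule D)+, simp, insert inv, algebra)
qed

text \<open>The coefficients are those of the single products of control points in
  \<open>quadratic_spline_product\<close>. For example, \<open>A 0 * A 2\<close> has double zeros at
  both \<open>v\<close> and \<open>w\<close>, so it can only be a multiple of
  \<open>Q 2\<close>.\<close>

lemma quadratic_piece_products:
  fixes u v w y x :: real
  defines "A \<equiv> \<lambda>i. quadratic_piece u v w y i x" and "Q \<equiv> \<lambda>i. quartic_piece u v w y i x"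
    and "\<beta> \<equiv> 1 / (w - u)" and "\<gamma> \<equiv> 1 / (y - v)"
  assumes "u < v" "v < w" "w < y"
  shows "A 0 * A 0 = Q 0 * (\<beta> * (w - v))"
    "A 0 * A 1 = Q 0 * (\<beta> * (v - u) / 2) + Q 1 * (\<beta> * (w - v) / 2)
        + Q 2 * (\<beta> * (w - v) * (\<gamma> * (y - w)) / 6)"
    "A 1 * A 1 = Q 1 * (\<beta> * (v - u)) + Q 2 * (2 / 3 + \<beta> * (v - u) * (\<gamma> * (y - w)) / 3)
        + Q 3 * (\<gamma> * (y - w))"
    "A 0 * A 2 = Q 2 * (\<beta> * (w - v) * (\<gamma> * (w - v)) / 6)"
    "A 1 * A 2 = Q 2 * (\<beta> * (v - u) * (\<gamma> * (w - v)) / 6) + Q 3 * (\<gamma> * (w - v) / 2)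
        + Q 4 * (\<gamma> * (y - w) / 2)"
    "A 2 * A 2 = Q 4 * (\<gamma> * (w - v))"
proof -
  define \<alpha> where "\<alpha> = inverse (w - v)"
  have inv: "\<alpha> * (w - v) = 1" "\<beta> * (w - u) = 1" "\<gamma> * (y - v) = 1"
    using assms by (auto simp: \<alpha>_def \<beta>_def \<gamma>_def)
  have Q: "Q 0 = \<beta> * \<alpha> ^ 3 * (w - x) ^ 4"
    "Q 1 = \<beta> * \<alpha> ^ 3 * ((x - u) * (w - x) ^ 3) + 3 * \<alpha> ^ 4 * ((x - v) * (w - x) ^ 3)"
    "Q 2 = 6 * \<alpha> ^ 4 * ((x - v)\<^sup>2 * (w - x)\<^sup>2)"
    "Q 3 = 3 * \<alpha> ^ 4 * ((x - v) ^ 3 * (w - x)) + \<gamma> * \<alpha> ^ 3 * ((y - x) * (x - v) ^ 3)"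
    "Q 4 = \<gamma> * \<alpha> ^ 3 * (x - v) ^ 4"
    by (simp_all add: Q_def quartic_pieces \<alpha>_def \<beta>_def \<gamma>_def divide_inverse power_inverse)
  have A: "A 0 = \<beta> * \<alpha> * (w - x)\<^sup>2"
    "A 1 = \<beta> * \<alpha> * ((x - u) * (w - x)) + \<gamma> * \<alpha> * ((y - x) * (x - v))"
    "A 2 = \<gamma> * \<alpha> * (x - v)\<^sup>2"
    by (simp_all add: A_def quadratic_pieces \<alpha>_def \<beta>_def \<gamma>_def divide_inverse)
  show "A 0 * A 0 = Q 0 * (\<beta> * (w - v))" "A 2 * A 2 = Q 4 * (\<gamma> * (w - v))"
    "A 0 * A 2 = Q 2 * (\<beta> * (w - v) * (\<gamma> * (w - v)) / 6)"
    unfolding A Q using inv by algebra+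
  show "A 0 * A 1 = Q 0 * (\<beta> * (v - u) / 2) + Q 1 * (\<beta> * (w - v) / 2)
      + Q 2 * (\<beta> * (w - v) * (\<gamma> * (y - w)) / 6)"
    unfolding A Q using inv by algebra
  show "A 1 * A 2 = Q 2 * (\<beta> * (v - u) * (\<gamma> * (w - v)) / 6) + Q 3 * (\<gamma> * (w - v) / 2)
      + Q 4 * (\<gamma> * (y - w) / 2)"
    unfolding A Q using inv by algebra
  show "A 1 * A 1 = Q 1 * (\<beta> * (v - u)) + Q 2 * (2 / 3 + \<beta> * (v - u) * (\<gamma> * (y - w)) / 3)
      + Q 3 * (\<gamma> * (y - w))"
    unfolding A Q using inv by algebra
qed

text \<open>\<open>L\<close> and \<open>R\<close> give the values of the spline at \<open>v\<close>
  and at \<open>w\<close>. By bilinearity it is enough to know the six products of pieces; the mixed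
  ones pair z_i w_j with z_j w_i, which is why the right side is symmetric.\<close>

lemma quadratic_spline_product:
  fixes z\<^sub>0 z\<^sub>1 z\<^sub>2 w\<^sub>0 w\<^sub>1 w\<^sub>2 :: complex and u v w y x :: real
  defines "A \<equiv> \<lambda>i. quadratic_piece u v w y i x" and "Q \<equiv> \<lambda>i. quartic_piece u v w y i x"
    and "L \<equiv> \<lambda>a b. ((w - v) *\<^sub>R a + (v - u) *\<^sub>R b) /\<^sub>R (w - u)"
    and "R \<equiv> \<lambda>b c. ((y - w) *\<^sub>R b + (w - v) *\<^sub>R c) /\<^sub>R (y - v)"
  assumes "u < v" "v < w" "w < y"
  shows "(A 0 *\<^sub>R z\<^sub>0 + A 1 *\<^sub>R z\<^sub>1 + A 2 *\<^sub>R z\<^sub>2) * (A 0 *\<^sub>R w\<^sub>0 + A 1 *\<^sub>R w\<^sub>1 + A 2 *\<^sub>R w\<^sub>2) =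
      Q 0 *\<^sub>R ((z\<^sub>0 * L w\<^sub>0 w\<^sub>1 + w\<^sub>0 * L z\<^sub>0 z\<^sub>1) / 2)
    + Q 1 *\<^sub>R ((z\<^sub>1 * L w\<^sub>0 w\<^sub>1 + w\<^sub>1 * L z\<^sub>0 z\<^sub>1) / 2)
    + Q 2 *\<^sub>R (2 / 3 * (z\<^sub>1 * w\<^sub>1) + (L z\<^sub>0 z\<^sub>1 * R w\<^sub>1 w\<^sub>2 + L w\<^sub>0 w\<^sub>1 * R z\<^sub>1 z\<^sub>2) / 6)
    + Q 3 *\<^sub>R ((z\<^sub>1 * R w\<^sub>1 w\<^sub>2 + w\<^sub>1 * R z\<^sub>1 z\<^sub>2) / 2)
    + Q 4 *\<^sub>R ((z\<^sub>2 * R w\<^sub>1 w\<^sub>2 + w\<^sub>2 * R z\<^sub>1 z\<^sub>2) / 2)"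
proof -
  define l\<^sub>0 l\<^sub>1 r\<^sub>0 r\<^sub>1 where lr: "l\<^sub>0 = complex_of_real (1 / (w - u) * (w - v))"
    "l\<^sub>1 = complex_of_real (1 / (w - u) * (v - u))"
    "r\<^sub>0 = complex_of_real (1 / (y - v) * (y - w))" "r\<^sub>1 = complex_of_real (1 / (y - v) * (w - v))"
  have L: "L a b = l\<^sub>0 * a + l\<^sub>1 * b" for a b
    by (simp add: L_def lr scaleR_conv_of_real inverse_eq_divide add_divide_distrib)
  have R: "R a b = r\<^sub>0 * a + r\<^sub>1 * b" for a b
    by (simp add: R_def lr scaleR_conv_of_real inverse_eq_divide add_divide_distrib)
  define A' Q' where "A' i = complex_of_real (A i)" and "Q' i = complex_of_real (Q i)" for i
  have products: "A' 0 * A' 0 = Q' 0 * l\<^sub>0"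
    "A' 0 * A' 1 = Q' 0 * (l\<^sub>1 / 2) + Q' 1 * (l\<^sub>0 / 2) + Q' 2 * (l\<^sub>0 * r\<^sub>0 / 6)"
    "A' 1 * A' 1 = Q' 1 * l\<^sub>1 + Q' 2 * (2 / 3 + l\<^sub>1 * r\<^sub>0 / 3) + Q' 3 * r\<^sub>0"
    "A' 0 * A' 2 = Q' 2 * (l\<^sub>0 * r\<^sub>1 / 6)"
    "A' 1 * A' 2 = Q' 2 * (l\<^sub>1 * r\<^sub>1 / 6) + Q' 3 * (r\<^sub>1 / 2) + Q' 4 * (r\<^sub>0 / 2)"
    "A' 2 * A' 2 = Q' 4 * r\<^sub>1"
    using quadratic_piece_products[OF assms(5-7), of x,
      THEN arg_cong[where f = complex_of_real]]
    by (simp_all only: A'_def Q'_def A_def Q_def lr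
        of_real_add of_real_mult of_real_divide of_real_numeral of_real_1)
  have "(A' 0 * z\<^sub>0 + A' 1 * z\<^sub>1 + A' 2 * z\<^sub>2) * (A' 0 * w\<^sub>0 + A' 1 * w\<^sub>1 + A' 2 * w\<^sub>2) =
      A' 0 * A' 0 * (z\<^sub>0 * w\<^sub>0) + A' 0 * A' 1 * (z\<^sub>0 * w\<^sub>1 + z\<^sub>1 * w\<^sub>0) + A' 1 * A' 1 * (z\<^sub>1 * w\<^sub>1)
      + A' 0 * A' 2 * (z\<^sub>0 * w\<^sub>2 + z\<^sub>2 * w\<^sub>0) + A' 1 * A' 2 * (z\<^sub>1 * w\<^sub>2 + z\<^sub>2 * w\<^sub>1)
        + A' 2 * A' 2 * (z\<^sub>2 * w\<^sub>2)"
    by (simp only: algebra_simps)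
  then show ?thesis
    unfolding products L R scaleR_conv_of_real A'_def[symmetric] Q'_def[symmetric]
    by (simp add: algebra_simps add_divide_distrib)
qed

section \<open>Gluing derivatives, telescoping sums and real integrals\<close>

text \<open>Limits within a union are limits within both parts. The premises are conditional because
  \<open>x\<close> may lie in only one part; within the other, closed part the filter at
  \<open>x\<close> is trivial and any limit holds.\<close>

lemma has_vector_derivative_within_Icc_combine:
  fixes f :: "real \<Rightarrow> 'a :: real_normed_vector"
  assumes "x \<in> {a..b} \<Longrightarrow> (f has_vector_derivative D) (at x within {a..b})"
    and "x \<in> {b..c} \<Longrightarrow> (f has_vector_derivative D) (at x within {b..c})"
    and "a \<le> b" "b \<le> c"
  shows "(f has_vector_derivative D) (at x within {a..c})"
proof -
  have trivial: "((\<lambda>y. (1 / \<bar>y - x\<bar>) *\<^sub>R (f y - (f x + (y - x) *\<^sub>R D))) \<longlongrightarrow> 0) (at x within S)"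
    if "x \<notin> S" "closed S" for S
    using that at_within_eq_bot_iff[of x S] by simp
  have iff: "(f has_vector_derivative D) (at x within S)
      \<longleftrightarrow> ((\<lambda>y. (1 / \<bar>y - x\<bar>) *\<^sub>R (f y - (f x + (y - x) *\<^sub>R D))) \<longlongrightarrow> 0) (at x within S)" for S
    by (simp add: has_vector_derivative_def has_derivative_within bounded_linear_scaleR_left)
  have "((\<lambda>y. (1 / \<bar>y - x\<bar>) *\<^sub>R (f y - (f x + (y - x) *\<^sub>R D))) \<longlongrightarrow> 0) (at x within {a..b} \<union> {b..c})"
    unfolding at_within_union
    using assms(1,2) trivial[of "{a..b}"] trivial[of "{b..c}"] iff by (intro filterlim_sup) auto
  then show ?thesis
    using assms(3,4) iff by (simp add: ivl_disj_un_two_touch)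
qed

lemma sum_int_Icc_rec:
  fixes f :: "int \<Rightarrow> 'a :: comm_monoid_add"
  assumes "a \<le> b"
  shows "sum f {a..b} = f a + sum f {a + 1..b}"
  using assms simp_from_to[of a b] by simp

lemma sum_int_telescope:
  fixes f :: "int \<Rightarrow> 'a :: ab_group_add"
  assumes "a \<le> b + 1"
  shows "(\<Sum>i = a..b. f (i + 1) - f i) = f (b + 1) - f a"
proof -
  \<comment> \<open>With upper bound \<open>n - 1\<close> the induction starts from the empty sum at
    \<open>n = a\<close>.\<close>
  have "(\<Sum>i = a..n - 1. f (i + 1) - f i) = f n - f a" if "a \<le> n" for n
    using that
  proof (induction n rule: int_ge_induct)
    case (step n)
    then have "{a..n + 1 - 1} = insert n {a..n - 1}" by auto
    then show ?case using step.IH by simp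
  qed simp
  from this[of "b + 1"] show ?thesis using assms by simp
qed

text \<open>The arc length coefficients are complex numbers. That their combination is real comes
  out of the integral and needs no computation with the coefficients.\<close>

lemma has_integral_of_real_imp:
  assumes "((\<lambda>x. complex_of_real (f x)) has_integral I) S"
  shows "(f has_integral Re I) S" "complex_of_real (Re I) = I"
proof -
  show "(f has_integral Re I) S"
    using has_integral_linear[OF assms bounded_linear_Re] by (simp add: o_def)
  have "((\<lambda>x. 0) has_integral Im I) S"
    using has_integral_linear[OF assms bounded_linear_Im] by (simp add: o_def)
  then have "Im I = 0" by simp
  then show "complex_of_real (Re I) = I" by (simp add: complex_eq_iff)
qed

section \<open>Control points of a product\<close>

text \<open>For knot differences \<open>d\<close> this is the value at \<open>t (k + 1)\<close> of
  the quadratic spline with control points \<open>z\<close>; for equal differences it is the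
  midpoint of \<open>z (k - 1)\<close> and \<open>z k\<close>.\<close>

definition midpoint_coeff :: "(int \<Rightarrow> complex) \<Rightarrow> (int \<Rightarrow> complex) \<Rightarrow> int \<Rightarrow> complex" where
  "midpoint_coeff d z k = (d (k + 2) * z (k - 1) + d (k + 1) * z k) / (d (k + 1) + d (k + 2))"

text \<open>The polarization of the control points of \<open>square_control_points\<close>.\<close>

definition product_coeff ::
    "(int \<Rightarrow> complex) \<Rightarrow> (int \<Rightarrow> complex) \<Rightarrow> (int \<Rightarrow> complex) \<Rightarrow> int \<Rightarrow> complex" where
  "product_coeff d z w j = (let k = j div 3 in
     if j mod 3 = 0 then
       2 / 3 * (z (k - 1) * w (k - 1))
       + (midpoint_coeff d z (k - 1) * midpoint_coeff d w k
          + midpoint_coeff d w (k - 1) * midpoint_coeff d z k) / 6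
     else if j mod 3 = 1 then (z (k - 1) * midpoint_coeff d w k
       + w (k - 1) * midpoint_coeff d z k) / 2
     else (z k * midpoint_coeff d w k + w k * midpoint_coeff d z k) / 2)"

text \<open>The last two are the second and third at \<open>k - 1\<close>, in the form needed for
  the window \<open>3 * k - 2, ..., 3 * k + 2\<close> of one knot interval.\<close>

lemma product_coeff_simps:
  "product_coeff d z w (3 * k) = 2 / 3 * (z (k - 1) * w (k - 1))
       + (midpoint_coeff d z (k - 1) * midpoint_coeff d w k
          + midpoint_coeff d w (k - 1) * midpoint_coeff d z k) / 6"
  "product_coeff d z w (3 * k + 1)
      = (z (k - 1) * midpoint_coeff d w k + w (k - 1) * midpoint_coeff d z k) / 2"
  "product_coeff d z w (3 * k + 2) = (z k * midpoint_coeff d w k + w k * midpoint_coeff d z k) / 2"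
  "product_coeff d z w (3 * k - 2)
      = (z (k - 2) * midpoint_coeff d w (k - 1) + w (k - 2) * midpoint_coeff d z (k - 1)) / 2"
  "product_coeff d z w (3 * k - 1)
      = (z (k - 1) * midpoint_coeff d w (k - 1) + w (k - 1) * midpoint_coeff d z (k - 1)) / 2"
proof -
  have dm: "(3 * k - 2) div 3 = k - 1" "(3 * k - 2) mod 3 = 1" "(3 * k - 1) div 3 = k - 1"
    "(3 * k - 1) mod 3 = 2"
     "(3 * k + 1) div 3 = k" "(3 * k + 1) mod 3 = 1" "(3 * k + 2) div 3 = k" "(3 * k + 2) mod 3 = 2"
    by presburger+
  show "product_coeff d z w (3 * k) = 2 / 3 * (z (k - 1) * w (k - 1))
       + (midpoint_coeff d z (k - 1) * midpoint_coeff d w k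
          + midpoint_coeff d w (k - 1) * midpoint_coeff d z k) / 6"
  "product_coeff d z w (3 * k + 1)
      = (z (k - 1) * midpoint_coeff d w k + w (k - 1) * midpoint_coeff d z k) / 2"
  "product_coeff d z w (3 * k + 2) = (z k * midpoint_coeff d w k + w k * midpoint_coeff d z k) / 2"
  "product_coeff d z w (3 * k - 2)
      = (z (k - 2) * midpoint_coeff d w (k - 1) + w (k - 2) * midpoint_coeff d z (k - 1)) / 2"
  "product_coeff d z w (3 * k - 1)
      = (z (k - 1) * midpoint_coeff d w (k - 1) + w (k - 1) * midpoint_coeff d z (k - 1)) / 2"
    by (simp_all only: product_coeff_def Let_def dm) simp_all
qed

text \<open>Extending the control points by zero lets the boundary intervals be treated like the others.\<close>

definition zero_outside :: "int \<Rightarrow> (int \<Rightarrow> complex) \<Rightarrow> int \<Rightarrow> complex" where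
  "zero_outside m z i = (if 0 \<le> i \<and> i \<le> m + 2 then z i else 0)"

text \<open>The padded spline vanishes at \<open>t 0\<close> and \<open>t (m + 5)\<close>, hence so
  do the extreme midpoint coefficients. Besides the four prescribed zeros, the list contains the
  indices outside \<open>{0..3 * m + 12}\<close> that the windows of the end intervals
  reach.\<close>

lemma product_coeff_zero_outside:
  assumes "m \<ge> 0" "j \<in> {-2, -1, 0, 1, 3 * m + 11, 3 * m + 12, 3 * m + 13, 3 * m + 14}"
  shows "product_coeff d (zero_outside m z) (zero_outside m w) j = 0"
proof -
  have j: "j = 3 * 0 - 2 \<or> j = 3 * 0 - 1 \<or> j = 3 * 0 \<or> j = 3 * 0 + 1 \<or> j = 3 * (m + 4) - 1 \<or>
     j = 3 * (m + 4) \<or> j = 3 * (m + 4) + 1 \<or> j = 3 * (m + 4) + 2"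
    using assms(2) by auto
  have z: "zero_outside m z (- 2) = 0" "zero_outside m z (- 1) = 0" "zero_outside m z (3 + m) = 0"
    "zero_outside m z (m + 4) = 0" "midpoint_coeff d (zero_outside m z) (-1) = 0"
    "midpoint_coeff d (zero_outside m z) (m + 4) = 0" for z
    using assms(1) by (simp_all add: zero_outside_def midpoint_coeff_def)
  from j show ?thesis
    by (elim disjE; simp only: product_coeff_simps) (simp_all add: z)
qed

section \<open>Knot sequences and their indicator splines\<close>

locale knot_sequence =
  fixes m :: int and t :: "int \<Rightarrow> real"
  assumes m_ge: "m \<ge> 2"
    and knot_less_Suc: "\<And>i. -1 \<le> i \<Longrightarrow> i \<le> m + 5 \<Longrightarrow> t i < t (i + 1)"
begin

abbreviation "s \<equiv> triple_knots t"
abbreviation "\<rho> \<equiv> extended_triple_knots m t"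
abbreviation "d \<equiv> \<lambda>k. complex_of_real (knot_diff t k)"

lemma knot_less:
  assumes "i < j" "-1 \<le> i" "j \<le> m + 6"
  shows "t i < t j"
  using assms
proof (induction j rule: int_gr_induct)
  case base
  then show ?case by (simp add: knot_less_Suc)
next
  case (step j)
  then have "t i < t j" by simp
  also have "t j < t (j + 1)" using step by (intro knot_less_Suc) auto
  finally show ?case .
qed

lemma knot_le: "i \<le> j \<Longrightarrow> -1 \<le> i \<Longrightarrow> j \<le> m + 6 \<Longrightarrow> t i \<le> t j"
  using knot_less[of i j] by (cases "i = j") auto

lemma knot_interval:
  assumes "a \<le> b" "t a \<le> x" "x < t b"
  obtains j where "a \<le> j" "j < b" "t j \<le> x" "x < t (j + 1)"
proof -
  have "\<exists>j. a \<le> j \<and> j < b \<and> t j \<le> x \<and> x < t (j + 1)"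
    using assms
  proof (induction b rule: int_ge_induct)
    case (step b)
    then show ?case by (cases "x < t b") fastforce+
  qed auto
  then show ?thesis using that by blast
qed

context
  fixes j :: int and x :: real
  assumes x: "t j \<le> x" "x < t (j + 1)"
begin

text \<open>One knot on the wrong side of \<open>x\<close> suffices. This covers the extreme indices
  \<open>-2\<close> and \<open>m + 6\<close>, where the other knot lies outside the meaningful
  range.\<close>

lemma bspline_0_knots:
  assumes j: "0 \<le> j" "j \<le> m + 4" and "k \<noteq> j" "-2 \<le> k" "k \<le> m + 6"
  shows "bspline t 0 k x = 0"
proof -
  have "t (k + 1) \<le> t j" if "k < j" using that assms by (intro knot_le) auto
  moreover have "t (j + 1) \<le> t k" if "k > j" using that assms by (intro knot_le) auto
  ultimately show ?thesis using x \<open>k \<noteq> j\<close> by (cases "k < j") auto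
qed

text \<open>Of the three copies of \<open>t j\<close> only the last, at index
  \<open>3 * j + 2\<close>, starts a nonempty knot interval. In \<open>\<rho>\<close> the extra knot
  in front shifts it to \<open>3 * j + 3\<close>.\<close>

lemma bspline_0_triple_knots:
  assumes j: "0 \<le> j" "j \<le> m + 4" and "k \<noteq> 3 * j + 2" "-3 \<le> k" "k \<le> 3 * m + 20"
  shows "bspline s 0 k x = 0"
proof -
  have "t ((k + 1) div 3) \<le> t j" if "k < 3 * j + 2" using that assms by (intro knot_le) auto
  moreover have "t (j + 1) \<le> t (k div 3)" if "k > 3 * j + 2" using that assms
    by (intro knot_le) auto
  ultimately show ?thesis using x \<open>k \<noteq> 3 * j + 2\<close>
    by (cases "k < 3 * j + 2") (auto simp: triple_knots_def)
qed

lemma bspline_0_extended_triple_knots: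
  assumes j: "0 \<le> j" "j \<le> m + 4" and "k \<noteq> 3 * j + 3" "0 \<le> k" "k \<le> 3 * m + 18"
  shows "bspline \<rho> 0 k x = 0"
proof -
  consider "k = 0" | "1 \<le> k" "k \<le> 3 * m + 17" | "k = 3 * m + 18"
    using assms by linarith
  then show ?thesis
  proof cases
    case 1
    have "t 0 \<le> t j" using j by (intro knot_le) auto
    then show ?thesis using x 1 m_ge by (simp add: extended_triple_knots_def triple_knots_def)
  next
    case 2
    then have "\<rho> k = s (k - 1)" "\<rho> (k + 1) = s (k - 1 + 1)"
      by (auto simp: extended_triple_knots_def)
    then have "bspline \<rho> 0 k x = bspline s 0 (k - 1) x" by simp
    also have "\<dots> = 0"
      using 2 assms by (intro bspline_0_triple_knots) auto
    finally show ?thesis .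
  next
    case 3
    have "t (j + 1) \<le> t (m + 5)" using j by (intro knot_le) auto
    moreover have "(3 * m + 17) div 3 = m + 5" by presburger
    ultimately show ?thesis using x 3 m_ge by (simp add: extended_triple_knots_def triple_knots_def)
  qed
qed

end

lemma knots_increasing:
  assumes "0 \<le> j" "j \<le> m + 4"
  shows "t (j - 1) < t j" "t j < t (j + 1)" "t (j + 1) < t (j + 2)"
  using assms by (auto intro: knot_less)

section \<open>The splines as polynomials on each knot interval\<close>

text \<open>The polynomial that continues the spline from \<open>[t j, t (j + 1))\<close> to the
  whole line. Unlike the spline's own formula there, such a piece can be evaluated at the right end
  and differentiated from both sides.\<close>

definition quadratic_spline_piece :: "(int \<Rightarrow> complex) \<Rightarrow> int \<Rightarrow> real \<Rightarrow> complex" where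
  "quadratic_spline_piece z j x
      = (let A = \<lambda>i. quadratic_piece (t (j - 1)) (t j) (t (j + 1)) (t (j + 2)) i x in
     A 0 *\<^sub>R z (j - 2) + A 1 *\<^sub>R z (j - 1) + A 2 *\<^sub>R z j)"

definition quartic_spline_piece :: "(int \<Rightarrow> complex) \<Rightarrow> int \<Rightarrow> real \<Rightarrow> complex" where
  "quartic_spline_piece p j x
      = (let A = \<lambda>i. quartic_piece (t (j - 1)) (t j) (t (j + 1)) (t (j + 2)) i x in
     A 0 *\<^sub>R p (3 * j - 2) + A 1 *\<^sub>R p (3 * j - 1) + A 2 *\<^sub>R p (3 * j) + A 3 *\<^sub>R p (3 * j + 1)
     + A 4 *\<^sub>R p (3 * j + 2))"

definition quintic_spline_piece :: "(int \<Rightarrow> complex) \<Rightarrow> int \<Rightarrow> real \<Rightarrow> complex" where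
  "quintic_spline_piece c j x
      = (let A = \<lambda>i. quintic_piece (t (j - 1)) (t j) (t (j + 1)) (t (j + 2)) i x in
     A 0 *\<^sub>R c (3 * j - 2) + A 1 *\<^sub>R c (3 * j - 1) + A 2 *\<^sub>R c (3 * j) + A 3 *\<^sub>R c (3 * j + 1)
     + A 4 *\<^sub>R c (3 * j + 2) + A 5 *\<^sub>R c (3 * j + 3))"

lemma quadratic_curve_eq_piece:
  assumes j: "0 \<le> j" "j \<le> m + 4" and x: "t j \<le> x" "x < t (j + 1)"
  shows "bspline_curve t 2 (m + 2) z x = quadratic_spline_piece (zero_outside m z) j x"
proof -
  have zero: "bspline t 0 k x = 0" if "k \<noteq> j" "-2 \<le> k" "k \<le> m + 6" for k
    using bspline_0_knots[OF x j] that .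
  have "bspline_curve t 2 (m + 2) z x = bspline_curve t 2 (m + 2) (zero_outside m z) x"
    unfolding bspline_curve_def by (rule sum.cong) (auto simp: zero_outside_def)
  also have "\<dots> = (\<Sum>i = j - int 2..j. bspline t 2 i x *\<^sub>R zero_outside m z i)"
    by (rule bspline_curve_local)
      (use j in \<open>auto simp: zero_outside_def intro!: zero simp del: bspline.simps\<close>)
  also have "\<dots> = quadratic_spline_piece (zero_outside m z) j x"
    using bspline_quadratic_pieces[of t j _ _ _ _ x, OF refl refl refl refl _ zero] x j
    by (simp add: sum_int_Icc_rec quadratic_spline_piece_def)
  finally show ?thesis .
qed

lemma triple_knots_window:
  "s (3 * j - 2) = t (j - 1)" "s (3 * j - 1) = t (j - 1)" "s (3 * j) = t j" "s (3 * j + 1) = t j"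
  "s (3 * j + 2) = t j"
  "s (3 * j + 3) = t (j + 1)" "s (3 * j + 4) = t (j + 1)" "s (3 * j + 5) = t (j + 1)"
  "s (3 * j + 6) = t (j + 2)" "s (3 * j + 7) = t (j + 2)"
proof -
  have "(3 * j - 2) div 3 = j - 1" "(3 * j - 1) div 3 = j - 1" "(3 * j) div 3 = j"
    "(3 * j + 1) div 3 = j" "(3 * j + 2) div 3 = j"
    "(3 * j + 3) div 3 = j + 1" "(3 * j + 4) div 3 = j + 1" "(3 * j + 5) div 3 = j + 1"
    "(3 * j + 6) div 3 = j + 2" "(3 * j + 7) div 3 = j + 2"
    by presburger+
  note dm = this
  show "s (3 * j - 2) = t (j - 1)" "s (3 * j - 1) = t (j - 1)" "s (3 * j) = t j"
    "s (3 * j + 1) = t j" "s (3 * j + 2) = t j"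
  "s (3 * j + 3) = t (j + 1)" "s (3 * j + 4) = t (j + 1)" "s (3 * j + 5) = t (j + 1)"
  "s (3 * j + 6) = t (j + 2)" "s (3 * j + 7) = t (j + 2)"
    by (simp_all only: triple_knots_def dm)
qed

lemmas triple_knots_window' = triple_knots_window
  triple_knots_window[unfolded add.commute[of "3 * j" for j]]

text \<open>The four conditions on \<open>p\<close> are for \<open>j = 0\<close>, whose window
  begins at \<open>-2\<close>, and for \<open>j = m + 4\<close>, whose window ends at
  \<open>3 * m + 14\<close>.\<close>

lemma quartic_curve_eq_piece:
  assumes j: "0 \<le> j" "j \<le> m + 4" and x: "t j \<le> x" "x < t (j + 1)"
    and p: "p (-2) = 0" "p (-1) = 0" "p (3 * m + 13) = 0" "p (3 * m + 14) = 0"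
  shows "bspline_curve s 4 (3 * m + 12) p x = quartic_spline_piece p j x"
proof -
  have zero: "bspline s 0 k x = 0" if "k \<noteq> 3 * j + 2" "-3 \<le> k" "k \<le> 3 * m + 20" for k
    using bspline_0_triple_knots[OF x j] that .
  have one: "bspline s 0 (3 * j + 2) x = 1"
    using x by (simp add: triple_knots_window')
  have zero': "bspline s 0 k x = 0" if "3 * j + 2 - 5 \<le> k" "k \<le> 3 * j + 2 + 5" "k \<noteq> 3 * j + 2" for k
    using zero[of k] that j by linarith
  have window: "s (3 * j + 2 - 4) = t (j - 1)" "s (3 * j + 2 - 3) = t (j - 1)"
    "s (3 * j + 2 - 2) = t j" "s (3 * j + 2 - 1) = t j" "s (3 * j + 2) = t j"
    "s (3 * j + 2 + 1) = t (j + 1)" "s (3 * j + 2 + 2) = t (j + 1)" "s (3 * j + 2 + 3) = t (j + 1)"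
    "s (3 * j + 2 + 4) = t (j + 2)" "s (3 * j + 2 + 5) = t (j + 2)"
    by (simp_all add: triple_knots_window')
  have "bspline_curve s 4 (3 * m + 12) p x
      = (\<Sum>i = (3 * j + 2) - int 4..3 * j + 2. bspline s 4 i x *\<^sub>R p i)"
  proof (rule bspline_curve_local)
    fix i assume "3 * j + 2 - int 4 \<le> i" "i \<le> 3 * j + 2" "i < 0 \<or> 3 * m + 12 < i"
    then have "i = -2 \<or> i = -1 \<or> i = 3 * m + 13 \<or> i = 3 * m + 14" using j by auto
    then show "p i = 0" using p by auto
  qed (use j zero in \<open>auto simp del: bspline.simps\<close>)
  also have "\<dots> = quartic_spline_piece p j x"
    using bspline_triple_pieces(1-5)[OF window one zero'] j
    by (simp add: sum_int_Icc_rec quartic_spline_piece_def add.assoc add.commute[of 1 "3 * j"])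
  finally show ?thesis .
qed

lemma extended_triple_knots_eq:
  "1 \<le> k \<Longrightarrow> k \<le> 3 * m + 18 \<Longrightarrow> \<rho> k = s (k - 1)"
  by (simp add: extended_triple_knots_def)

text \<open>For these \<open>j\<close> the window avoids the single end knots of
  \<open>\<rho>\<close>. The value \<open>j = m + 3\<close> lies to the right of the period but is
  needed for the value at \<open>t (m + 3)\<close>, since the splines are half-open.\<close>

lemma bspline_quintic_eq_pieces:
  assumes j: "2 \<le> j" "j \<le> m + 3" and x: "t j \<le> x" "x < t (j + 1)"
  defines "A \<equiv> \<lambda>i. quintic_piece (t (j - 1)) (t j) (t (j + 1)) (t (j + 2)) i x"
  shows "bspline \<rho> 5 (3 * j - 2) x = A 0" "bspline \<rho> 5 (3 * j - 1) x = A 1"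
    "bspline \<rho> 5 (3 * j) x = A 2" "bspline \<rho> 5 (3 * j + 1) x = A 3"
    "bspline \<rho> 5 (3 * j + 2) x = A 4" "bspline \<rho> 5 (3 * j + 3) x = A 5"
proof -
  have zero: "bspline \<rho> 0 k x = 0" if "k \<noteq> 3 * j + 3" "0 \<le> k" "k \<le> 3 * m + 18" for k
    using bspline_0_extended_triple_knots[OF x _ _ that] j by simp
  have window: "\<rho> (3 * j + 3 - 4) = t (j - 1)" "\<rho> (3 * j + 3 - 3) = t (j - 1)"
    "\<rho> (3 * j + 3 - 2) = t j" "\<rho> (3 * j + 3 - 1) = t j" "\<rho> (3 * j + 3) = t j"
    "\<rho> (3 * j + 3 + 1) = t (j + 1)" "\<rho> (3 * j + 3 + 2) = t (j + 1)" "\<rho> (3 * j + 3 + 3) = t (j + 1)"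
    "\<rho> (3 * j + 3 + 4) = t (j + 2)" "\<rho> (3 * j + 3 + 5) = t (j + 2)"
    using j by (simp_all add: extended_triple_knots_eq triple_knots_window')
  have one: "bspline \<rho> 0 (3 * j + 3) x = 1"
    using x window by simp
  have zero': "bspline \<rho> 0 k x = 0" if "3 * j + 3 - 5 \<le> k" "k \<le> 3 * j + 3 + 5" "k \<noteq> 3 * j + 3" for k
    using zero[of k] that j by linarith
  show "bspline \<rho> 5 (3 * j - 2) x = A 0" "bspline \<rho> 5 (3 * j - 1) x = A 1"
    "bspline \<rho> 5 (3 * j) x = A 2" "bspline \<rho> 5 (3 * j + 1) x = A 3"
    "bspline \<rho> 5 (3 * j + 2) x = A 4" "bspline \<rho> 5 (3 * j + 3) x = A 5"
    using bspline_triple_pieces(6-11)[OF window one zero'] unfolding A_def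
    by (simp_all add: add.commute[of 1 "3 * j"] add.commute[of 2 "3 * j"])
qed

lemma quintic_curve_eq_piece:
  assumes j: "2 \<le> j" "j \<le> m + 3" and x: "t j \<le> x" "x < t (j + 1)"
  shows "bspline_curve \<rho> 5 (3 * m + 13) c x = quintic_spline_piece c j x"
proof -
  have zero: "bspline \<rho> 0 k x = 0" if "k \<noteq> 3 * j + 3" "0 \<le> k" "k \<le> 3 * m + 18" for k
    using bspline_0_extended_triple_knots[OF x _ _ that] j by simp
  have "bspline_curve \<rho> 5 (3 * m + 13) c x
      = (\<Sum>i = (3 * j + 3) - int 5..3 * j + 3. bspline \<rho> 5 i x *\<^sub>R c i)"
    by (rule bspline_curve_local) (use j zero in \<open>auto simp del: bspline.simps\<close>)
  also have "\<dots> = quintic_spline_piece c j x"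
    using bspline_quintic_eq_pieces[OF assms]
    by (simp add: sum_int_Icc_rec quintic_spline_piece_def add.assoc)
  finally show ?thesis .
qed

text \<open>The left-end values on the next interval and the right-end values on this one are the
  same ratios of knot differences, attached to the same control points.\<close>

lemma spline_pieces_match:
  assumes j: "0 \<le> j" "j \<le> m + 3"
  shows "quadratic_spline_piece z (j + 1) (t (j + 1)) = quadratic_spline_piece z j (t (j + 1))"
    and "quintic_spline_piece c (j + 1) (t (j + 1)) = quintic_spline_piece c j (t (j + 1))"
proof -
  have less: "t (j - 1) < t j" "t j < t (j + 1)" "t (j + 1) < t (j + 2)" "t (j + 2) < t (j + 3)"
    using j by (auto intro: knot_less)
  have "j + 1 - 2 = j - 1" "j + 1 - 1 = j" "j + 1 + 1 = j + 2" "j + 1 + 2 = j + 3"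
    "3 * (j + 1) - 2 = 3 * j + 1" "3 * (j + 1) - 1 = 3 * j + 2" "3 * (j + 1) = 3 * j + 3"
    by auto
  note shift = this
  show "quadratic_spline_piece z (j + 1) (t (j + 1)) = quadratic_spline_piece z j (t (j + 1))"
    unfolding quadratic_spline_piece_def Let_def shift
    using less by (simp only: quadratic_piece_left quadratic_piece_right) simp
  show "quintic_spline_piece c (j + 1) (t (j + 1)) = quintic_spline_piece c j (t (j + 1))"
    unfolding quintic_spline_piece_def Let_def shift
    using less by (simp only: quintic_piece_left quintic_piece_right)
      (simp add: add.commute[of _ "3 * j"])
qed

lemma quadratic_spline_piece_mult:
  assumes j: "0 \<le> j" "j \<le> m + 4"
  shows "quadratic_spline_piece z j x * quadratic_spline_piece w j x =
    quartic_spline_piece (product_coeff d z w) j x"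
proof -
  \<comment> \<open>Written in terms of knots, these are the end values \<open>L\<close> and
    \<open>R\<close> of \<open>quadratic_spline_product\<close>.\<close>
  have mid: "midpoint_coeff d z (j - 1)
      = ((t (j + 1) - t j) *\<^sub>R z (j - 2) + (t j - t (j - 1)) *\<^sub>R z (j - 1))
          /\<^sub>R (t (j + 1) - t (j - 1))"
    "midpoint_coeff d z j = ((t (j + 2) - t (j + 1)) *\<^sub>R z (j - 1) + (t (j + 1) - t j) *\<^sub>R z j) /\<^sub>R (t (j + 2) - t j)" for z
  proof -
    have "j - 1 + 2 = j + 1" "j - 1 + 1 = j" "j - 1 - 1 = j - 2" by auto
    moreover have "d j + d (j + 1) = of_real (t (j + 1) - t (j - 1))"
      "d (j + 1) + d (j + 2) = of_real (t (j + 2) - t j)"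
      by (simp_all add: knot_diff_def add.commute[of _ j])
    moreover have "knot_diff t (j + 2) = t (j + 2) - t (j + 1)"
      "knot_diff t (j + 1) = t (j + 1) - t j"
      "knot_diff t j = t j - t (j - 1)"
      by (simp_all add: knot_diff_def add.commute[of _ j])
    ultimately show "midpoint_coeff d z (j - 1)
        = ((t (j + 1) - t j) *\<^sub>R z (j - 2) + (t j - t (j - 1)) *\<^sub>R z (j - 1))
          /\<^sub>R (t (j + 1) - t (j - 1))"
      "midpoint_coeff d z j
          = ((t (j + 2) - t (j + 1)) *\<^sub>R z (j - 1) + (t (j + 1) - t j) *\<^sub>R z j)
          /\<^sub>R (t (j + 2) - t j)"
      by (simp_all only: midpoint_coeff_def scaleR_conv_of_real divide_inverse mult.commute of_real_inverse)
  qed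
  show ?thesis
    unfolding quadratic_spline_piece_def quartic_spline_piece_def Let_def product_coeff_simps mid
    by (rule quadratic_spline_product) (use knots_increasing[OF j] in auto)
qed

lemma quintic_spline_piece_has_vector_derivative:
  assumes j: "0 \<le> j" "j \<le> m + 4"
    and c: "\<And>k. 3 * j - 2 \<le> k \<Longrightarrow> k \<le> 3 * j + 2 \<Longrightarrow> c (k + 1) - c k = ((s (k + 5) - s k) / 5) *\<^sub>R p k"
  shows "(quintic_spline_piece c j has_vector_derivative quartic_spline_piece p j x) (at x)"
proof -
  define u v w y where uvwy: "u = t (j - 1)" "v = t j" "w = t (j + 1)" "y = t (j + 2)"
  have less: "u < v" "v < w" "w < y"
    using knots_increasing[OF j] by (auto simp: uvwy)
  have solve: "a = (5 / g) *\<^sub>R e" if "e = (g / 5) *\<^sub>R a" "g \<noteq> 0" for a e :: complex and g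
    using that by simp
  have p: "p (3 * j - 2) = (5 / (w - u)) *\<^sub>R (c (3 * j - 1) - c (3 * j - 2))"
    "p (3 * j - 1) = (5 / (w - u)) *\<^sub>R (c (3 * j) - c (3 * j - 1))"
    "p (3 * j) = (5 / (w - v)) *\<^sub>R (c (3 * j + 1) - c (3 * j))"
    "p (3 * j + 1) = (5 / (y - v)) *\<^sub>R (c (3 * j + 2) - c (3 * j + 1))"
    "p (3 * j + 2) = (5 / (y - v)) *\<^sub>R (c (3 * j + 3) - c (3 * j + 2))"
    using c[of "3 * j - 2"] c[of "3 * j - 1"] c[of "3 * j"] c[of "3 * j + 1"] c[of "3 * j + 2"] less
    by (intro solve; simp add: triple_knots_window' uvwy[symmetric] add.commute[of _ "3 * j"])+
  note D = quintic_piece_has_derivative[OF less]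
  have "(quintic_spline_piece c j has_vector_derivative
      (- 5 / (w - u) * quartic_piece u v w y 0 x) *\<^sub>R c (3 * j - 2)
    + (5 / (w - u) * quartic_piece u v w y 0 x - 5 / (w - u) * quartic_piece u v w y 1 x) *\<^sub>R c (3 * j - 1)
    + (5 / (w - u) * quartic_piece u v w y 1 x - 5 / (w - v) * quartic_piece u v w y 2 x) *\<^sub>R c (3 * j)
    + (5 / (w - v) * quartic_piece u v w y 2 x - 5 / (y - v) * quartic_piece u v w y 3 x) *\<^sub>R c (3 * j + 1)
    + (5 / (y - v) * quartic_piece u v w y 3 x - 5 / (y - v) * quartic_piece u v w y 4 x) *\<^sub>R c (3 * j + 2)
    + (5 / (y - v) * quartic_piece u v w y 4 x) *\<^sub>R c (3 * j + 3)) (at x)"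
    unfolding quintic_spline_piece_def[abs_def] Let_def uvwy[symmetric]
    by (rule derivative_eq_intros D refl)+ simp
  \<comment> \<open>Summation by parts: each quartic piece occurs with two neighbouring control
    points of \<open>c\<close>, and five times their difference over the support length is the value
    of \<open>p\<close>.\<close>
  also have "?this \<longleftrightarrow> (quintic_spline_piece c j
      has_vector_derivative quartic_spline_piece p j x) (at x)"
    unfolding quartic_spline_piece_def Let_def uvwy[symmetric] p
    by (simp add: algebra_simps)
  finally show ?thesis .
qed

section \<open>Products and antiderivatives on the whole range\<close>

abbreviation "spline_coeff z w \<equiv> product_coeff d (zero_outside m z) (zero_outside m w)"

lemma quadratic_curve_mult:
  assumes "\<And>k. 0 \<le> k \<Longrightarrow> k \<le> 3 * m + 12 \<Longrightarrow> p k = spline_coeff z w k"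
  shows "bspline_curve t 2 (m + 2) z x * bspline_curve t 2 (m + 2) w x
      = bspline_curve s 4 (3 * m + 12) p x"
proof -
  have eq: "bspline_curve s 4 (3 * m + 12) p x
      = bspline_curve s 4 (3 * m + 12) (spline_coeff z w) x"
    unfolding bspline_curve_def by (rule sum.cong) (use assms in auto)
  show ?thesis
  proof (cases "t 0 \<le> x \<and> x < t (m + 5)")
    case True
    then obtain j where j: "0 \<le> j" "j \<le> m + 4" and x: "t j \<le> x" "x < t (j + 1)"
      using knot_interval[of 0 "m + 5" x] m_ge by force
    have "spline_coeff z w (- 2) = 0" "spline_coeff z w (- 1) = 0"
      "spline_coeff z w (3 * m + 13) = 0"
      "spline_coeff z w (3 * m + 14) = 0"
      using m_ge by (auto intro!: product_coeff_zero_outside)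
    then show ?thesis
      unfolding eq using j x
      by (simp add: quadratic_curve_eq_piece quartic_curve_eq_piece quadratic_spline_piece_mult)
  next
    case False
    \<comment> \<open>Off \<open>[t 0, t (m + 5))\<close> every indicator vanishes, so both sides
      are zero and the identity holds for every real \<open>x\<close>.\<close>
    have "bspline t 0 k x = 0" if "0 \<le> k" "k \<le> m + 4" for k
      using False knot_le[of 0 k] knot_le[of "k + 1" "m + 5"] that by auto
    then have 1: "bspline_curve t 2 (m + 2) z x = 0"
      by (intro bspline_curve_eq_0) auto
    have "bspline s 0 k x = 0" if "0 \<le> k" "k \<le> 3 * m + 16" for k
    proof -
      have "0 \<le> k div 3" "k div 3 \<le> m + 6" "(k + 1) div 3 \<le> m + 5" "-1 \<le> (k + 1) div 3"
        using that by auto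
      then show ?thesis
        using False knot_le[of 0 "k div 3"] knot_le[of "(k + 1) div 3" "m + 5"]
        by (auto simp: triple_knots_def)
    qed
    then have "bspline_curve s 4 (3 * m + 12) p x = 0"
      by (intro bspline_curve_eq_0) auto
    with 1 show ?thesis by simp
  qed
qed

text \<open>At the right end the half-open splines already follow the next piece, which has the same
  value there; hence \<open>j\<close> stops one short of the last interval.\<close>

lemma quadratic_curve_eq_closed_piece:
  assumes j: "0 \<le> j" "j \<le> m + 3" and x: "t j \<le> x" "x \<le> t (j + 1)"
  shows "bspline_curve t 2 (m + 2) z x = quadratic_spline_piece (zero_outside m z) j x"
proof (cases "x = t (j + 1)")
  case True
  have "t (j + 1) < t (j + 2)" using j by (auto intro: knot_less)
  then show ?thesis
    using True quadratic_curve_eq_piece[of "j + 1" x z] spline_pieces_match(1)[OF j] j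
      by (simp add: add.assoc)
qed (use assms quadratic_curve_eq_piece in auto)

lemma quintic_curve_eq_closed_piece:
  assumes j: "2 \<le> j" "j \<le> m + 2" and x: "t j \<le> x" "x \<le> t (j + 1)"
  shows "bspline_curve \<rho> 5 (3 * m + 13) c x = quintic_spline_piece c j x"
proof (cases "x = t (j + 1)")
  case True
  have "t (j + 1) < t (j + 2)" using j by (auto intro: knot_less)
  then show ?thesis
    using True quintic_curve_eq_piece[of "j + 1" x c] spline_pieces_match(2)[of j] j
      by (simp add: add.assoc)
qed (use assms quintic_curve_eq_piece in auto)

lemma quintic_curve_has_vector_derivative:
  assumes c: "\<And>k. 0 \<le> k \<Longrightarrow> k \<le> 3 * m + 12 \<Longrightarrow> c (k + 1) - c k
      = ((s (k + 5) - s k) / 5) *\<^sub>R spline_coeff z w k"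
    and x: "x \<in> {t 2..t (m + 3)}"
  shows "(bspline_curve \<rho> 5 (3 * m + 13) c has_vector_derivative
      bspline_curve t 2 (m + 2) z x * bspline_curve t 2 (m + 2) w x) (at x within {t 2..t (m + 3)})"
    (is "(?C has_vector_derivative ?D x) _")
proof -
  have piece: "(?C has_vector_derivative ?D x) (at x within {t j..t (j + 1)})"
    if j: "2 \<le> j" "j \<le> m + 2" and x: "x \<in> {t j..t (j + 1)}" for j x
  proof (rule has_vector_derivative_transform[OF x])
    show "?C y = quintic_spline_piece c j y" if "y \<in> {t j..t (j + 1)}" for y
      using j that by (intro quintic_curve_eq_closed_piece) auto
    have "?D x = quartic_spline_piece (spline_coeff z w) j x"
      using j x quadratic_curve_eq_closed_piece[of j x z] quadratic_curve_eq_closed_piece[of j x w]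
      by (simp add: quadratic_spline_piece_mult)
    moreover have "(quintic_spline_piece c j
        has_vector_derivative quartic_spline_piece (spline_coeff z w) j x) (at x)"
      using j by (intro quintic_spline_piece_has_vector_derivative c) auto
    ultimately show "(quintic_spline_piece c j
        has_vector_derivative ?D x) (at x within {t j..t (j + 1)})"
      by (simp add: has_vector_derivative_at_within)
  qed
  \<comment> \<open>The closed knot intervals are attached one by one. At a common knot both sides
    supply the same derivative \<open>?D x\<close>, because \<open>?D\<close> is defined by the
    curves themselves and not by pieces.\<close>
  have "x \<in> {t 2..t n} \<longrightarrow> (?C has_vector_derivative ?D x) (at x within {t 2..t n})" if "3 \<le> n"
    "n \<le> m + 3" for n x
    using that
  proof (induction n rule: int_ge_induct)
    case base
    then show ?case using piece[of 2 x] m_ge by simp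
  next
    case (step n)
    have "t 2 \<le> t n" "t n \<le> t (n + 1)" using step.hyps step.prems by (auto intro: knot_le)
    note le = this
    show ?case
      by (intro impI, rule has_vector_derivative_within_Icc_combine[where b = "t n"])
        (use le step.IH step.hyps step.prems piece[of n x] in simp_all)
  qed
  then show ?thesis using x m_ge by simp
qed

section \<open>The coefficient formulas as increments of control points\<close>

lemma midpoint_coeff_pred:
  "midpoint_coeff e v (k - 1) = (e (k + 1) * v (k - 2) + e k * v (k - 1)) / (e k + e (k + 1))"
  by (simp add: midpoint_coeff_def add.commute[of 1 k])

lemma knot_diff_pos: "0 \<le> i \<Longrightarrow> i \<le> m + 6 \<Longrightarrow> 0 < knot_diff t i"
  by (simp add: knot_diff_def knot_less)

lemma knot_diff_add_nonzero: "0 \<le> i \<Longrightarrow> i \<le> m + 5 \<Longrightarrow> d i + d (i + 1) \<noteq> 0"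
  using knot_diff_pos[of i] knot_diff_pos[of "i + 1"] of_real_eq_0_iff[of "knot_diff t i
      + knot_diff t (i + 1)", where 'a = complex]
  by simp

lemma index_cases [consumes 2, case_names zero start triple triple1 triple2 stop]:
  assumes "0 \<le> k" "k \<le> 3 * m + 12"
  obtains "k \<in> {0, 1, 3 * m + 11, 3 * m + 12}"
    | "k = 2"
    | i where "k = 3 * i" "1 \<le> i" "i \<le> m + 3"
    | i where "k = 3 * i + 1" "1 \<le> i" "i \<le> m + 2"
    | i where "k = 3 * i + 2" "1 \<le> i" "i \<le> m + 2"
    | "k = 3 * m + 10"
proof -
  define i where "i = k div 3"
  have "k = 3 * i \<or> k = 3 * i + 1 \<or> k = 3 * i + 2"
    unfolding i_def by presburger
  then consider "k = 3 * i" | "k = 3 * i + 1" | "k = 3 * i + 2"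
    by blast
  then show ?thesis
  proof cases
    case 1
    then have "i = 0 \<or> 1 \<le> i \<and> i \<le> m + 3 \<or> i = m + 4" using assms by presburger
    then show ?thesis using 1 that(1,3) by auto
  next
    case 2
    then have "i = 0 \<or> 1 \<le> i \<and> i \<le> m + 2 \<or> i = m + 3" using assms by presburger
    then show ?thesis using 2 that(1,4,6) by auto
  next
    case 3
    then have "i = 0 \<or> 1 \<le> i \<and> i \<le> m + 2 \<or> i = m + 3" using assms by presburger
    then show ?thesis using 3 that(1,2,5) by auto
  qed
qed

lemma gap_simps:
  "s (3 * i + 5) - s (3 * i) = knot_diff t (i + 1)"
  "s (3 * i + 1 + 5) - s (3 * i + 1) = knot_diff t (i + 1) + knot_diff t (i + 2)"
  "s (3 * i + 2 + 5) - s (3 * i + 2) = knot_diff t (i + 1) + knot_diff t (i + 2)"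
  by (simp_all add: triple_knots_window' knot_diff_def add.commute[of _ i])

text \<open>The two boundary values are instances of the general formulas, for
  \<open>3 * k + 2\<close> at \<open>k = 0\<close> and for \<open>3 * k + 1\<close> at
  \<open>k = m + 3\<close>, with one neighbouring control point equal to zero. For indices from
  \<open>-1\<close> to \<open>m + 3\<close> padding changes nothing.\<close>

lemma spline_coeff_simps:
  assumes "z (-1) = 0" "z (m + 3) = 0" "w (-1) = 0" "w (m + 3) = 0"
  shows "k \<in> {0, 1, 3 * m + 11, 3 * m + 12} \<Longrightarrow> spline_coeff z w k = 0"
    "spline_coeff z w 2 = d 1 / (d 1 + d 2) * (z 0 * w 0)"
    "spline_coeff z w (3 * m + 10) = d (m + 5) / (d (m + 4) + d (m + 5)) * (z (m + 2) * w (m + 2))"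
    "1 \<le> i \<Longrightarrow> i \<le> m + 3 \<Longrightarrow> spline_coeff z w (3 * i) = product_coeff d z w (3 * i)"
    "1 \<le> i \<Longrightarrow> i \<le> m + 2 \<Longrightarrow> spline_coeff z w (3 * i + 1) = product_coeff d z w (3 * i + 1)"
    "1 \<le> i \<Longrightarrow> i \<le> m + 2 \<Longrightarrow> spline_coeff z w (3 * i + 2) = product_coeff d z w (3 * i + 2)"
proof -
  have ext: "zero_outside m v i = v i" if "v (-1) = 0" "v (m + 3) = 0" "-1 \<le> i" "i \<le> m + 3" for v i
  proof -
    have "i = -1 \<or> 0 \<le> i \<and> i \<le> m + 2 \<or> i = m + 3" using that by auto
    then show ?thesis using that by (auto simp: zero_outside_def)
  qed
  have mid: "midpoint_coeff d (zero_outside m v) i = midpoint_coeff d v i"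
    if "v (-1) = 0" "v (m + 3) = 0" "0 \<le> i" "i \<le> m + 3" for v i
    unfolding midpoint_coeff_def using that by (simp add: ext)
  show "spline_coeff z w k = 0" if "k \<in> {0, 1, 3 * m + 11, 3 * m + 12}"
    by (rule product_coeff_zero_outside) (use that m_ge in auto)
  have pair: "(a * (x / y * b) + b * (x / y * a)) / 2 = x / y * (a * b)" for a b x y :: complex
    by (simp add: mult.commute mult.left_commute)
  have "midpoint_coeff d v 0 = d 1 / (d 1 + d 2) * v 0" if "v (-1) = 0" for v
    using that by (simp add: midpoint_coeff_def)
  then have "spline_coeff z w (3 * 0 + 2) = d 1 / (d 1 + d 2) * (z 0 * w 0)"
    unfolding product_coeff_simps using assms m_ge by (simp only: mid ext pair)
  then show "spline_coeff z w 2 = d 1 / (d 1 + d 2) * (z 0 * w 0)" by simp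
  have idx: "3 * m + 10 = 3 * (m + 3) + 1" "m + 3 + 2 = m + 5" "m + 3 + 1 = m + 4"
    "m + 3 - 1 = m + 2" by auto
  have "midpoint_coeff d v (m + 3) = d (m + 5) / (d (m + 4) + d (m + 5)) * v (m + 2)"
    if "v (m + 3) = 0" for v
    using that by (simp add: midpoint_coeff_def idx)
  then show "spline_coeff z w (3 * m + 10)
      = d (m + 5) / (d (m + 4) + d (m + 5)) * (z (m + 2) * w (m + 2))"
    unfolding idx(1) product_coeff_simps idx(4) using assms m_ge by (simp only: mid ext pair)
  show "1 \<le> i \<Longrightarrow> i \<le> m + 3 \<Longrightarrow> spline_coeff z w (3 * i) = product_coeff d z w (3 * i)"
    "1 \<le> i \<Longrightarrow> i \<le> m + 2 \<Longrightarrow> spline_coeff z w (3 * i + 1) = product_coeff d z w (3 * i + 1)"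
    "1 \<le> i \<Longrightarrow> i \<le> m + 2 \<Longrightarrow> spline_coeff z w (3 * i + 2) = product_coeff d z w (3 * i + 2)"
    unfolding product_coeff_simps using assms m_ge by (simp_all add: mid ext)
qed

lemma square_control_points_imp_spline_coeff:
  assumes "z (-1) = 0" "z (m + 3) = 0" and p: "square_control_points m d z p"
    and k: "0 \<le> k" "k \<le> 3 * m + 12"
  shows "p k = spline_coeff z z k"
  using k
proof (cases rule: index_cases)
  case zero
  then have "p k = 0" using p by (auto simp: square_control_points_def)
  then show ?thesis using zero spline_coeff_simps(1)[of z z k] assms by simp
next
  case start
  then show ?thesis using p spline_coeff_simps(2)[of z z] assms
    by (simp add: square_control_points_def power2_eq_square)
next
  case (triple i)
  then have "p k = 2 / 3 * (z (i - 1))\<^sup>2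
      + 1 / 3 * midpoint_coeff d z (i - 1) * midpoint_coeff d z i"
    using p unfolding square_control_points_def midpoint_coeff_pred
    unfolding midpoint_coeff_def by simp
  then have "p k = product_coeff d z z (3 * i)"
    by (simp add: product_coeff_simps power2_eq_square)
  then show ?thesis using triple spline_coeff_simps(4)[of z z i] assms by simp
next
  case (triple1 i)
  then have "p k = z (i - 1) * midpoint_coeff d z i"
    using p unfolding square_control_points_def midpoint_coeff_def by simp
  then have "p k = product_coeff d z z (3 * i + 1)"
    by (simp add: product_coeff_simps)
  then show ?thesis using triple1 spline_coeff_simps(5)[of z z i] assms by simp
next
  case (triple2 i)
  then have "p k = z i * midpoint_coeff d z i"
    using p unfolding square_control_points_def midpoint_coeff_def by simp
  then have "p k = product_coeff d z z (3 * i + 2)"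
    by (simp add: product_coeff_simps)
  then show ?thesis using triple2 spline_coeff_simps(6)[of z z i] assms by simp
next
  case stop
  then show ?thesis using p spline_coeff_simps(3)[of z z] assms
    by (simp add: square_control_points_def power2_eq_square)
qed

text \<open>The increment that integration prescribes: a control point of degree 4 times one fifth
  of the length of the support of its B-spline.\<close>

definition spline_step :: "(int \<Rightarrow> complex) \<Rightarrow> (int \<Rightarrow> complex) \<Rightarrow> int \<Rightarrow> complex" where
  "spline_step z w k = ((s (k + 5) - s k) / 5) *\<^sub>R spline_coeff z w k"

text \<open>For indices \<open>3 * i + 1\<close> and \<open>3 * i + 2\<close> the support spans two
  knot intervals, and its length cancels the denominator of the midpoint coefficient. For
  \<open>3 * i\<close> it spans one interval, so the denominators stay.\<close>

lemma spline_step_simps: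
  assumes "z (-1) = 0" "z (m + 3) = 0" "w (-1) = 0" "w (m + 3) = 0"
  shows "k \<in> {0, 1, 3 * m + 11, 3 * m + 12} \<Longrightarrow> spline_step z w k = 0"
    "spline_step z w 2 = d 1 / 5 * (z 0 * w 0)"
    "spline_step z w (3 * m + 10) = d (m + 5) / 5 * (z (m + 2) * w (m + 2))"
    "1 \<le> i \<Longrightarrow> i \<le> m + 3 \<Longrightarrow> spline_step z w (3 * i) = d (i + 1) / 5 * product_coeff d z w (3 * i)"
    "1 \<le> i \<Longrightarrow> i \<le> m + 2 \<Longrightarrow> spline_step z w (3 * i + 1) =
      (z (i - 1) * (d (i + 2) * w (i - 1) + d (i + 1) * w i) + w (i - 1) * (d (i + 2) * z (i - 1)
        + d (i + 1) * z i)) / 10"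
    "1 \<le> i \<Longrightarrow> i \<le> m + 2 \<Longrightarrow> spline_step z w (3 * i + 2) =
      (z i * (d (i + 2) * w (i - 1) + d (i + 1) * w i) + w i *
        (d (i + 2) * z (i - 1) + d (i + 1) * z i)) / 10"
proof -
  note coeff = spline_coeff_simps[OF assms]
  have cancel: "((a + b) / 5) *\<^sub>R (x / (of_real a + of_real b) * y) = x / 5 * y"
    "((a + b) / 5) *\<^sub>R ((x * (v / (of_real a + of_real b))
        + y * (u / (of_real a + of_real b))) / 2) = (x * v + y * u) / 10"
    if "0 < a" "0 < b" for a b :: real and x y u v :: complex
  proof -
    define n where "n = complex_of_real a + complex_of_real b"
    have n: "n \<noteq> 0"
      using that of_real_eq_0_iff[of "a + b", where 'a = complex] by (simp add: n_def)
    have scale: "((a + b) / 5) *\<^sub>R e = n / 5 * e" for e :: complex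
      by (simp add: n_def scaleR_conv_of_real)
    show "((a + b) / 5) *\<^sub>R (x / (of_real a + of_real b) * y) = x / 5 * y"
      "((a + b) / 5) *\<^sub>R ((x * (v / (of_real a + of_real b))
          + y * (u / (of_real a + of_real b))) / 2) = (x * v + y * u) / 10"
      unfolding n_def[symmetric] scale using n by (simp_all add: field_simps)
  qed
  show "spline_step z w k = 0" if "k \<in> {0, 1, 3 * m + 11, 3 * m + 12}"
    using coeff(1)[OF that] by (simp add: spline_step_def)
  have "s (2 + 5) - s 2 = knot_diff t 1 + knot_diff t 2"
    using gap_simps(3)[of 0] by simp
  then show "spline_step z w 2 = d 1 / 5 * (z 0 * w 0)"
    unfolding spline_step_def coeff using m_ge by (simp only: cancel knot_diff_pos)
  have "s (3 * m + 10 + 5) - s (3 * m + 10) = knot_diff t (m + 4) + knot_diff t (m + 5)"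
    using gap_simps(2)[of "m + 3"] by (simp add: add.commute)
  then show "spline_step z w (3 * m + 10) = d (m + 5) / 5 * (z (m + 2) * w (m + 2))"
    unfolding spline_step_def coeff using m_ge by (simp only: cancel knot_diff_pos)
  show "spline_step z w (3 * i) = d (i + 1) / 5 * product_coeff d z w (3 * i)" if "1 \<le> i"
    "i \<le> m + 3"
    unfolding spline_step_def coeff(4)[OF that] gap_simps(1) by (simp add: scaleR_conv_of_real)
  show "spline_step z w (3 * i + 1) =
      (z (i - 1) * (d (i + 2) * w (i - 1) + d (i + 1) * w i) + w (i - 1) * (d (i + 2) * z (i - 1)
        + d (i + 1) * z i)) / 10"
    if "1 \<le> i" "i \<le> m + 2"
    unfolding spline_step_def coeff(5)[OF that] gap_simps
    unfolding product_coeff_simps midpoint_coeff_def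
    by (rule cancel) (use that in \<open>auto intro: knot_diff_pos\<close>)
  show "spline_step z w (3 * i + 2) =
      (z i * (d (i + 2) * w (i - 1) + d (i + 1) * w i) + w i *
        (d (i + 2) * z (i - 1) + d (i + 1) * z i)) / 10"
    if "1 \<le> i" "i \<le> m + 2"
    unfolding spline_step_def coeff(6)[OF that] gap_simps
    unfolding product_coeff_simps midpoint_coeff_def
    by (rule cancel) (use that in \<open>auto intro: knot_diff_pos\<close>)
qed

lemma all_steps_iff:
  "(\<forall>k \<in> {0..3 * m + 12}. Q k) \<longleftrightarrow>
     Q 0 \<and> Q 1 \<and> Q 2 \<and> (\<forall>i \<in> {1..m + 3}. Q (3 * i)) \<and> (\<forall>i \<in> {1..m + 2}. Q (3 * i + 1) \<and> Q (3 * i + 2)) \<and>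
     Q (3 * m + 10) \<and> Q (3 * m + 11) \<and> Q (3 * m + 12)" (is "?L \<longleftrightarrow> ?R")
proof
  assume ?R
  show ?L
  proof
    fix k assume "k \<in> {0..3 * m + 12}"
    then have "0 \<le> k" "k \<le> 3 * m + 12" by auto
    then show "Q k" using \<open>?R\<close> by (cases rule: index_cases) auto
  qed
qed (use m_ge in auto)

text \<open>In this form the conditions become one recurrence: it can be solved from any initial
  value, is invariant under translation of \<open>c\<close>, and telescopes.\<close>

lemma ph_control_points_iff:
  assumes "z (-1) = 0" "z (m + 3) = 0"
  shows "ph_control_points m d z c \<longleftrightarrow> (\<forall>k \<in> {0..3 * m + 12}. c (k + 1) - c k = spline_step z z k)"
proof -
  note steps = spline_step_simps[of z z, OF assms assms]
  have 1: "c (3 * i + 1) - c (3 * i) = spline_step z z (3 * i) \<longleftrightarrow>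
     c (3 * i + 1) = c (3 * i) + d (i + 1) / 5 *
          (2 / 3 * (z (i - 1))\<^sup>2
           + 1 / 3 * ((d (i + 1) * z (i - 2) + d i * z (i - 1)) / (d i + d (i + 1)))
                   * ((d (i + 2) * z (i - 1) + d (i + 1) * z i) / (d (i + 1) + d (i + 2))))"
    if "i \<in> {1..m + 3}" for i
  proof -
    have "spline_step z z (3 * i) = d (i + 1) / 5 *
          (2 / 3 * (z (i - 1))\<^sup>2 + 1 / 3 * midpoint_coeff d z (i - 1) * midpoint_coeff d z i)"
      using that by (simp add: steps(4) product_coeff_simps power2_eq_square)
    then show ?thesis
      unfolding midpoint_coeff_pred unfolding midpoint_coeff_def by (auto simp: algebra_simps)
  qed
  have 2: "c (3 * i + 1 + 1) - c (3 * i + 1) = spline_step z z (3 * i + 1) \<longleftrightarrow>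
      c (3 * i + 2) = c (3 * i + 1) + z (i - 1) / 5 * (d (i + 2) * z (i - 1) + d (i + 1) * z i)"
    "c (3 * i + 2 + 1) - c (3 * i + 2) = spline_step z z (3 * i + 2) \<longleftrightarrow>
      c (3 * i + 3) = c (3 * i + 2) + z i / 5 * (d (i + 2) * z (i - 1) + d (i + 1) * z i)"
    if "i \<in> {1..m + 2}" for i
  proof -
    have "spline_step z z (3 * i + 1) = z (i - 1) / 5 * (d (i + 2) * z (i - 1) + d (i + 1) * z i)"
      "spline_step z z (3 * i + 2) = z i / 5 * (d (i + 2) * z (i - 1) + d (i + 1) * z i)"
      using that by (simp_all add: steps(5,6))
    then show "c (3 * i + 1 + 1) - c (3 * i + 1) = spline_step z z (3 * i + 1) \<longleftrightarrow>
      c (3 * i + 2) = c (3 * i + 1) + z (i - 1) / 5 * (d (i + 2) * z (i - 1) + d (i + 1) * z i)"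
     "c (3 * i + 2 + 1) - c (3 * i + 2) = spline_step z z (3 * i + 2) \<longleftrightarrow>
      c (3 * i + 3) = c (3 * i + 2) + z i / 5 * (d (i + 2) * z (i - 1) + d (i + 1) * z i)"
      by (auto simp: diff_eq_eq add.commute)
  qed
  have eq: "a - b = x \<longleftrightarrow> a = b + x" for a b x :: complex
    by (auto simp: algebra_simps)
  have 3: "c (0 + 1) - c 0 = spline_step z z 0 \<longleftrightarrow> c 1 = c 0"
    "c (1 + 1) - c 1 = spline_step z z 1 \<longleftrightarrow> c 2 = c 1"
    "c (2 + 1) - c 2 = spline_step z z 2 \<longleftrightarrow> c 3 = c 2 + d 1 / 5 * (z 0)\<^sup>2"
    "c (3 * m + 10 + 1) - c (3 * m + 10) = spline_step z z (3 * m + 10) \<longleftrightarrow>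
      c (3 * m + 11) = c (3 * m + 10) + d (m + 5) / 5 * (z (m + 2))\<^sup>2"
    "c (3 * m + 11 + 1) - c (3 * m + 11) = spline_step z z (3 * m + 11) \<longleftrightarrow> c (3 * m + 12)
        = c (3 * m + 11)"
    "c (3 * m + 12 + 1) - c (3 * m + 12) = spline_step z z (3 * m + 12) \<longleftrightarrow> c (3 * m + 13)
        = c (3 * m + 12)"
    using steps(1)[of 0] steps(1)[of 1] steps(1)[of "3 * m + 11"] steps(1)[of "3 * m + 12"]
    unfolding eq steps(2,3) power2_eq_square by (simp_all add: add.commute[of _ "3 * m"])
  show ?thesis
    unfolding all_steps_iff 3 ph_control_points_def using 1 2 by auto
qed

lemma arc_length_coeffs_imp:
  assumes "z (-1) = 0" "z (m + 3) = 0" and l: "arc_length_coeffs m d z l"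
    and k: "0 \<le> k" "k \<le> 3 * m + 12"
  shows "l (k + 1) - l k = spline_step z (\<lambda>i. cnj (z i)) k"
proof -
  note steps = spline_step_simps[of z "\<lambda>i. cnj (z i)", OF assms(1,2)]
  have z: "cnj (z (-1)) = 0" "cnj (z (m + 3)) = 0" using assms by auto
  note l = l[unfolded arc_length_coeffs_def]
  have l_stop: "l (3 * m + 10 + 1) - l (3 * m + 10) = d (m + 5) / 5 * (z (m + 2) * cnj (z (m + 2)))"
    using l by (simp add: add.commute[of _ "3 * m"])
  from k show ?thesis
  proof (cases rule: index_cases)
    case zero
    then show ?thesis using steps(1)[OF z zero] l by (auto simp: add.commute[of _ "3 * m"])
  next
    case start
    then show ?thesis using l by (simp add: steps(2)[OF z])
  next
    case stop
    show ?thesis unfolding stop l_stop steps(3)[OF z] ..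
  next
    case (triple i)
    define a h b where "a = d i" and "h = d (i + 1)" and "b = d (i + 2)"
    have nz: "a + h \<noteq> 0" "h + b \<noteq> 0"
      using knot_diff_add_nonzero[of i] knot_diff_add_nonzero[of "i + 1"] triple
      by (auto simp: a_def h_def b_def add.commute[of _ i])
    have "l (k + 1) - l k = 2 * h / 15 * (z (i - 1) * cnj (z (i - 1)))
          + h / (15 * (a + h) * (h + b)) *
            (a * b * (z (i - 1) * cnj (z (i - 1)))
             + h\<^sup>2 / 2 * (z (i - 2) * cnj (z i) + z i * cnj (z (i - 2)))
             + h * b / 2
                 * (z (i - 2) * cnj (z (i - 1)) + z (i - 1) * cnj (z (i - 2)))
             + a * h / 2
                 * (z (i - 1) * cnj (z i) + z i * cnj (z (i - 1))))"
      using l triple by (simp add: a_def h_def b_def)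
    \<comment> \<open>The long bracket is half the symmetrized product of the two midpoint
      coefficients of \<open>z\<close> and its conjugate, expanded over the common
      denominator.\<close>
    also have "\<dots> = h / 5 * (2 / 3 * (z (i - 1) * cnj (z (i - 1)))
       + ((h * z (i - 2) + a * z (i - 1)) / (a + h) * ((b * cnj (z (i - 1)) + h * cnj (z i)) / (h + b))
        + (h * cnj (z (i - 2)) + a * cnj (z (i - 1))) / (a + h) * ((b * z (i - 1) + h * z i) / (h + b))) / 6)"
      using nz by (simp add: divide_simps) algebra
    also have "\<dots> = spline_step z (\<lambda>i. cnj (z i)) k"
      using steps(4)[OF z] triple
      by (simp only: product_coeff_simps midpoint_coeff_pred a_def h_def b_def)
        (simp only: midpoint_coeff_def)
    finally show ?thesis .
  next
    case (triple1 i)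
    have "l (3 * i + 2) = l (3 * i + 1) + 1 / 5 * (d (i + 2) * (z (i - 1) * cnj (z (i - 1)))
           + d (i + 1) / 2 * (z (i - 1) * cnj (z i) + z i * cnj (z (i - 1))))"
      using l triple1(2,3) by (meson atLeastAtMost_iff)
    then have "l (k + 1) - l k = 1 / 5 * (d (i + 2) * (z (i - 1) * cnj (z (i - 1)))
           + d (i + 1) / 2 * (z (i - 1) * cnj (z i) + z i * cnj (z (i - 1))))"
      by (simp add: triple1(1) add.commute[of _ "3 * i"])
    then show ?thesis
      unfolding triple1(1) steps(5)[OF z triple1(2,3)]
        by (simp add: algebra_simps add_divide_distrib)
  next
    case (triple2 i)
    have "l (3 * i + 3) = l (3 * i + 2) + 1 / 5 * (d (i + 1) * (z i * cnj (z i))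
           + d (i + 2) / 2 * (z (i - 1) * cnj (z i) + z i * cnj (z (i - 1))))"
      using l triple2(2,3) by (meson atLeastAtMost_iff)
    then have "l (k + 1) - l k = 1 / 5 * (d (i + 1) * (z i * cnj (z i))
           + d (i + 2) / 2 * (z (i - 1) * cnj (z i) + z i * cnj (z (i - 1))))"
      by (simp add: triple2(1) add.commute[of _ "3 * i"])
    then show ?thesis
      unfolding triple2(1) steps(6)[OF z triple2(2,3)]
        by (simp add: algebra_simps add_divide_distrib)
  qed
qed

section \<open>Values at the ends of the period\<close>

text \<open>This explains the shape of the closing conditions: their summands are five times the
  increments of the curve's control points.\<close>

lemma spline_step_telescope:
  assumes c: "\<And>k. 0 \<le> k \<Longrightarrow> k \<le> 3 * m + 12 \<Longrightarrow> c (k + 1) - c k = spline_step z w k"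
    and "0 \<le> a" "a \<le> b + 1" "b \<le> 3 * m + 12"
    and p: "\<And>k. 0 \<le> k \<Longrightarrow> k \<le> 3 * m + 12 \<Longrightarrow> p k = spline_coeff z w k"
  shows "(\<Sum>j = a..b. (s (j + 5) - s j) *\<^sub>R p j) = 5 *\<^sub>R (c (b + 1) - c a)"
proof -
  have "(\<Sum>j = a..b. (s (j + 5) - s j) *\<^sub>R p j) = (\<Sum>j = a..b. 5 *\<^sub>R (c (j + 1) - c j))"
    using assms by (intro sum.cong) (auto simp: spline_step_def)
  also have "\<dots> = 5 *\<^sub>R (c (b + 1) - c a)"
    by (simp only: scaleR_sum_right[symmetric] sum_int_telescope[OF assms(3)])
  finally show ?thesis .
qed

lemma quintic_curve_at_knot:
  assumes j: "2 \<le> j" "j \<le> m + 3"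
  shows "bspline_curve \<rho> 5 (3 * m + 13) c (t j) =
      bspline \<rho> 5 (3 * j - 2) (t j) *\<^sub>R c (3 * j - 2)
        + bspline \<rho> 5 (3 * j - 1) (t j) *\<^sub>R c (3 * j - 1)
    + bspline \<rho> 5 (3 * j) (t j) *\<^sub>R c (3 * j)"
   "bspline \<rho> 5 (3 * j - 2) (t j)
       = (knot_diff t (j + 1))\<^sup>2 / (knot_diff t j + knot_diff t (j + 1))\<^sup>2"
   "bspline \<rho> 5 (3 * j - 1) (t j)
       = 2 * knot_diff t (j + 1) * knot_diff t j / (knot_diff t j + knot_diff t (j + 1))\<^sup>2"
   "bspline \<rho> 5 (3 * j) (t j) = (knot_diff t j)\<^sup>2 / (knot_diff t j + knot_diff t (j + 1))\<^sup>2"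
proof -
  have less: "t (j - 1) < t j" "t j < t (j + 1)" "t (j + 1) < t (j + 2)"
    using j by (auto intro: knot_less)
  have d: "knot_diff t (j + 1) = t (j + 1) - t j" "knot_diff t j = t j - t (j - 1)"
    "knot_diff t j + knot_diff t (j + 1) = t (j + 1) - t (j - 1)"
    by (simp_all add: knot_diff_def)
  note pieces = bspline_quintic_eq_pieces[OF j order.refl less(2)]
  show "bspline_curve \<rho> 5 (3 * m + 13) c (t j) =
      bspline \<rho> 5 (3 * j - 2) (t j) *\<^sub>R c (3 * j - 2)
        + bspline \<rho> 5 (3 * j - 1) (t j) *\<^sub>R c (3 * j - 1)
    + bspline \<rho> 5 (3 * j) (t j) *\<^sub>R c (3 * j)"
    unfolding quintic_curve_eq_piece[OF j order.refl less(2)] pieces quintic_spline_piece_def Let_def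
    using quintic_piece_left[OF less] by simp
  show "bspline \<rho> 5 (3 * j - 2) (t j)
      = (knot_diff t (j + 1))\<^sup>2 / (knot_diff t j + knot_diff t (j + 1))\<^sup>2"
   "bspline \<rho> 5 (3 * j - 1) (t j)
       = 2 * knot_diff t (j + 1) * knot_diff t j / (knot_diff t j + knot_diff t (j + 1))\<^sup>2"
   "bspline \<rho> 5 (3 * j) (t j) = (knot_diff t j)\<^sup>2 / (knot_diff t j + knot_diff t (j + 1))\<^sup>2"
    unfolding pieces quintic_piece_left[OF less] d(3) unfolding d by simp_all
qed

text \<open>The three weights at a knot depend only on the two adjacent knot differences. The
  assumptions make these agree at \<open>t 2\<close> and \<open>t (m + 3)\<close>, so the control
  points can be subtracted with an index shift of \<open>3 * m + 3\<close>.\<close>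

lemma quintic_curve_period:
  assumes "knot_diff t (m + 3) = knot_diff t 2" "knot_diff t (m + 4) = knot_diff t 3"
  shows "bspline_curve \<rho> 5 (3 * m + 13) c (t (m + 3)) - bspline_curve \<rho> 5 (3 * m + 13) c (t 2) =
      bspline \<rho> 5 4 (t 2) *\<^sub>R (c (3 * m + 7) - c 4) + bspline \<rho> 5 5 (t 2) *\<^sub>R (c (3 * m + 8) - c 5)
    + bspline \<rho> 5 6 (t 2) *\<^sub>R (c (3 * m + 9) - c 6)"
proof -
  have idx: "3 * (m + 3) - 2 = 3 * m + 7" "3 * (m + 3) - 1 = 3 * m + 8" "3 * (m + 3) = 3 * m + 9"
    "m + 3 + 1 = m + 4"
    "3 * 2 - 2 = (4 :: int)" "3 * 2 - 1 = (5 :: int)" "3 * 2 = (6 :: int)" "2 + 1 = (3 :: int)"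
    by auto
  note at = quintic_curve_at_knot[of 2, unfolded idx] quintic_curve_at_knot[of "m + 3",
    unfolded idx]
  show ?thesis
    using at m_ge assms by (simp add: algebra_simps)
qed

section \<open>The closed curve and its arc length\<close>

abbreviation "Z z \<equiv> bspline_curve t 2 (m + 2) z"
abbreviation "C c \<equiv> bspline_curve \<rho> 5 (3 * m + 13) c"
abbreviation "period \<equiv> {t 2..t (m + 3)}"

lemma period_nonempty: "t 2 < t (m + 3)"
  using m_ge by (auto intro: knot_less)

text \<open>The three weights at the knot sum to 1. The point \<open>t 2\<close> is enough, because
  antiderivatives that agree at one point agree on the whole period.\<close>

lemma quintic_curve_add_const:
  "C (\<lambda>i. c i + a) (t 2) = C c (t 2) + a"
proof -
  define A B where "A = knot_diff t 2" and "B = knot_diff t 3"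
  have "0 < A" "0 < B"
    using m_ge by (auto simp: A_def B_def intro: knot_diff_pos)
  then have "B\<^sup>2 / (A + B)\<^sup>2 + 2 * B * A / (A + B)\<^sup>2 + A\<^sup>2 / (A + B)\<^sup>2 = (A + B)\<^sup>2 / (A + B)\<^sup>2"
    by (simp only: add_divide_distrib[symmetric]) (simp add: power2_eq_square algebra_simps)
  then have weights: "bspline \<rho> 5 4 (t 2) + bspline \<rho> 5 5 (t 2) + bspline \<rho> 5 6 (t 2) = 1"
    using quintic_curve_at_knot(2-4)[of 2] m_ge \<open>0 < A\<close> \<open>0 < B\<close> by (simp add: A_def B_def)
  have "C (\<lambda>i. c i + a) (t 2) = C c (t 2)
      + (bspline \<rho> 5 4 (t 2) + bspline \<rho> 5 5 (t 2) + bspline \<rho> 5 6 (t 2)) *\<^sub>R a"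
    using quintic_curve_at_knot(1)[of 2] m_ge by (simp add: scaleR_add_right scaleR_add_left)
  then show ?thesis
    by (simp only: weights scaleR_one)
qed

context
  fixes z :: "int \<Rightarrow> complex"
  assumes z: "z (-1) = 0" "z (m + 3) = 0"
begin

lemma ph_control_points_exist: "\<exists>c. c 0 = a \<and> ph_control_points m d z c"
proof -
  define c where "c k = a + (\<Sum>i = 0..k - 1. spline_step z z i)" for k
  have "c (k + 1) - c k = spline_step z z k" if "0 \<le> k" for k
  proof -
    have "{0..k} = insert k {0..k - 1}" using that by auto
    then show ?thesis by (simp add: c_def)
  qed
  then have "ph_control_points m d z c"
    unfolding ph_control_points_iff[OF z] by simp
  moreover have "c 0 = a"
    by (simp add: c_def)
  ultimately show ?thesis by blast
qed

lemma ph_curve_has_vector_derivative: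
  assumes "ph_control_points m d z c" "x \<in> period"
  shows "(C c has_vector_derivative (Z z x)\<^sup>2) (at x within period)"
  unfolding power2_eq_square
proof (rule quintic_curve_has_vector_derivative[OF _ assms(2)])
  show "c (k + 1) - c k = ((s (k + 5) - s k) / 5) *\<^sub>R spline_coeff z z k" if "0 \<le> k"
    "k \<le> 3 * m + 12" for k
    using assms(1) that unfolding ph_control_points_iff[OF z] spline_step_def by simp
qed

lemma antiderivative_iff_ph_curve:
  "(\<forall>x \<in> period. (r has_vector_derivative (Z z x)\<^sup>2) (at x within period)) \<longleftrightarrow>
    (\<exists>c. ph_control_points m d z c \<and> (\<forall>x \<in> period. r x = C c x))"
proof
  assume "\<exists>c. ph_control_points m d z c \<and> (\<forall>x \<in> period. r x = C c x)"
  then show "\<forall>x \<in> period. (r has_vector_derivative (Z z x)\<^sup>2) (at x within period)"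
    using ph_curve_has_vector_derivative by (blast intro: has_vector_derivative_transform)
next
  assume r: "\<forall>x \<in> period. (r has_vector_derivative (Z z x)\<^sup>2) (at x within period)"
  obtain c\<^sub>0 where c\<^sub>0: "ph_control_points m d z c\<^sub>0"
    using ph_control_points_exist by blast
  \<comment> \<open>Translating the control points makes the curve start at \<open>r (t 2)\<close>;
    the difference from \<open>r\<close> is then a constant equal to zero.\<close>
  define c where "c i = c\<^sub>0 i + (r (t 2) - C c\<^sub>0 (t 2))" for i
  have c: "ph_control_points m d z c"
    using c\<^sub>0 by (simp add: c_def ph_control_points_iff[OF z])
  have start: "C c (t 2) = r (t 2)"
    using quintic_curve_add_const[of c\<^sub>0 "r (t 2) - C c\<^sub>0 (t 2)"] by (simp add: c_def[abs_def])
  have "((\<lambda>x. r x - C c x) has_vector_derivative 0) (at x within period)" if "x \<in> period" for x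
    using has_vector_derivative_diff[OF bspec[OF r that] ph_curve_has_vector_derivative[OF c that]]
    by simp
  then have "\<exists>a. \<forall>x \<in> period. r x - C c x = a"
    by (rule has_vector_derivative_zero_constant[OF convex_real_interval(5)]) auto
  then obtain a where a: "\<And>x. x \<in> period \<Longrightarrow> r x - C c x = a"
    by blast
  then have "a = 0"
    using start period_nonempty a[of "t 2"] by simp
  then show "\<exists>c. ph_control_points m d z c \<and> (\<forall>x \<in> period. r x = C c x)"
    using c a by auto
qed

lemma antiderivative_closed:
  assumes r: "\<forall>x \<in> period. (r has_vector_derivative (Z z x)\<^sup>2) (at x within period)"
    and periodic: "knot_diff t (m + 3) = knot_diff t 2" "knot_diff t (m + 4) = knot_diff t 3"
    and p: "square_control_points m d z p"
    and closed: "\<forall>k \<in> {0, 1, 2}. (\<Sum>j = 6 - k..3 * m + 8 - k. (s (j + 5) - s j) *\<^sub>R p j) = 0"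
  shows "r (t 2) = r (t (m + 3))"
proof -
  obtain c where c: "ph_control_points m d z c" "\<forall>x \<in> period. r x = C c x"
    using r antiderivative_iff_ph_curve by blast
  have tele: "(\<Sum>j = a..b. (s (j + 5) - s j) *\<^sub>R p j) = 5 *\<^sub>R (c (b + 1) - c a)"
    if "0 \<le> a" "a \<le> b + 1" "b \<le> 3 * m + 12" for a b
  proof (rule spline_step_telescope[OF _ that square_control_points_imp_spline_coeff[OF z p]])
    show "c (k + 1) - c k = spline_step z z k" if "0 \<le> k" "k \<le> 3 * m + 12" for k
      using c(1) that unfolding ph_control_points_iff[OF z] by simp
  qed
  \<comment> \<open>For \<open>k = 0, 1, 2\<close> these are exactly the three differences of
    control points that occur in \<open>quintic_curve_period\<close>.\<close>
  have "c (3 * m + 8 - k + 1) - c (6 - k) = 0" if "k \<in> {0, 1, 2}" for k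
  proof -
    have "5 *\<^sub>R (c (3 * m + 8 - k + 1) - c (6 - k)) = 0"
      using tele[of "6 - k" "3 * m + 8 - k"] bspec[OF closed that] that m_ge by auto
    then show ?thesis by simp
  qed
  from this[of 0] this[of 1] this[of 2] have "c (3 * m + 9) - c 6 = 0" "c (3 * m + 8) - c 5 = 0"
    "c (3 * m + 7) - c 4 = 0"
    by (simp_all add: add.commute[of _ "3 * m"])
  then have "C c (t (m + 3)) - C c (t 2) = 0"
    unfolding quintic_curve_period[OF periodic, of c] by simp
  then show ?thesis
    using c(2) period_nonempty by simp
qed

text \<open>The Pythagorean-hodograph property: the speed is the modulus of a square, that is,
  \<open>z\<close> times its conjugate. So it is again a product of quadratic splines, without a
  square root, and \<open>l\<close> gives its antiderivative.\<close>

lemma antiderivative_has_arc_length: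
  assumes r: "\<forall>x \<in> period. (r has_vector_derivative (Z z x)\<^sup>2) (at x within period)"
    and l: "arc_length_coeffs m d z l"
  shows "\<exists>L. has_arc_length r (t 2) (t (m + 3)) L \<and> complex_of_real L = C l (t (m + 3)) - C l (t 2)"
proof -
  have norm_sq: "Z z x * Z (\<lambda>i. cnj (z i)) x = complex_of_real ((norm (Z z x))\<^sup>2)" for x
    by (simp only: bspline_curve_cnj complex_norm_square)
  have "(C l has_vector_derivative complex_of_real ((norm (Z z x))\<^sup>2)) (at x within period)"
    if "x \<in> period" for x
    unfolding norm_sq[symmetric]
    by (rule quintic_curve_has_vector_derivative
        [OF arc_length_coeffs_imp[OF z l, unfolded spline_step_def] that])
  then have "((\<lambda>x. complex_of_real ((norm (Z z x))\<^sup>2)) has_integral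
      C l (t (m + 3)) - C l (t 2)) period"
    using period_nonempty by (intro fundamental_theorem_of_calculus) auto
  note int = has_integral_of_real_imp[OF this]
  have speed: "norm (vector_derivative r (at x within period)) = (norm (Z z x))\<^sup>2" if "x \<in> period"
    for x
    using vector_derivative_within_closed_interval[OF period_nonempty that bspec[OF r that]]
      by (simp add: norm_power)
  have "has_arc_length r (t 2) (t (m + 3)) (Re (C l (t (m + 3)) - C l (t 2)))"
    unfolding has_arc_length_def by (rule has_integral_eq[OF _ int(1)]) (simp add: speed)
  then show ?thesis
    using int(2) by blast
qed

end

end

text \<open>That the curve is the given spline with arbitrary initial point is expressed in two
  parts: every initial value extends to control points, and the splines so obtained are precisely
  the antiderivatives on the period. Derivatives are one-sided at its ends. The equation for the
  real number \<open>L\<close> also asserts that the complex right side is real.\<close>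

theorem mainTheorem13:
  fixes m :: int
    and t :: "int \<Rightarrow> real"
    and z p l :: "int \<Rightarrow> complex"
    and d :: "int \<Rightarrow> real"
    and s \<rho> :: "int \<Rightarrow> real"
    and Z :: "real \<Rightarrow> complex"
  assumes "m \<ge> 2"
    and "t 0 = 0"
    and "\<forall>i \<in> {-1..m + 5}. t i < t (i + 1)"
    and "z (-1) = 0" and "z (m + 3) = 0"
    and "d = knot_diff t"
    and "s = triple_knots t"
    and "\<rho> = extended_triple_knots m t"
    and "Z = bspline_curve t 2 (m + 2) z"
    and "square_control_points m (\<lambda>k. complex_of_real (d k)) z p"
    and "arc_length_coeffs m (\<lambda>k. complex_of_real (d k)) z l"
  shows "(\<forall>x. (Z x)\<^sup>2 = bspline_curve s 4 (3 * m + 12) p x) \<and>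
    (d (m + 3) = d 2 \<and> d (m + 4) = d 3 \<and>
     (\<forall>k \<in> {0, 1, 2}. (\<Sum>j = 6 - k..3 * m + 8 - k. (s (j + 5) - s j) *\<^sub>R p j) = 0) \<longrightarrow>
      (\<forall>a. \<exists>c. c 0 = a \<and> ph_control_points m (\<lambda>k. complex_of_real (d k)) z c) \<and>
      (\<forall>r.
        (\<forall>x \<in> {t 2..t (m + 3)}.
            (r has_vector_derivative (Z x)\<^sup>2) (at x within {t 2..t (m + 3)})) \<longleftrightarrow>
        (\<exists>c. ph_control_points m (\<lambda>k. complex_of_real (d k)) z c \<and>
            (\<forall>x \<in> {t 2..t (m + 3)}. r x = bspline_curve \<rho> 5 (3 * m + 13) c x))) \<and>
      (\<forall>r.
        (\<forall>x \<in> {t 2..t (m + 3)}.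
            (r has_vector_derivative (Z x)\<^sup>2) (at x within {t 2..t (m + 3)})) \<longrightarrow>
        r (t 2) = r (t (m + 3)) \<and>
        (\<exists>L. has_arc_length r (t 2) (t (m + 3)) L \<and>
          complex_of_real L =
              bspline \<rho> 5 4 (t 2) *\<^sub>R (l (3 * m + 7) - l 4)
            + bspline \<rho> 5 5 (t 2) *\<^sub>R (l (3 * m + 8) - l 5)
            + bspline \<rho> 5 6 (t 2) *\<^sub>R (l (3 * m + 9) - l 6))))"
proof -
  interpret knot_sequence m t
    using assms(1,3) by unfold_locales auto
  note z = assms(4,5)
  note p = assms(10)[unfolded assms(6)] and l = assms(11)[unfolded assms(6)]
  have square: "(bspline_curve t 2 (m + 2) z x)\<^sup>2 = bspline_curve (triple_knots t) 4 (3 * m + 12) p x" for x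
    unfolding power2_eq_square
    by (rule quadratic_curve_mult[OF square_control_points_imp_spline_coeff[OF z p]])
  show ?thesis
    unfolding assms(6-9)
  proof (intro conjI impI allI; (elim conjE)?)
    fix r
    assume r: "\<forall>x \<in> {t 2..t (m + 3)}. (r
        has_vector_derivative (bspline_curve t 2 (m + 2) z x)\<^sup>2) (at x within {t 2..t (m + 3)})"
      and periodic: "knot_diff t (m + 3) = knot_diff t 2" "knot_diff t (m + 4) = knot_diff t 3"
    show "\<exists>L. has_arc_length r (t 2) (t (m + 3)) L \<and>
          complex_of_real L =
              bspline (extended_triple_knots m t) 5 4 (t 2) *\<^sub>R (l (3 * m + 7) - l 4)
            + bspline (extended_triple_knots m t) 5 5 (t 2) *\<^sub>R (l (3 * m + 8) - l 5)
            + bspline (extended_triple_knots m t) 5 6 (t 2) *\<^sub>R (l (3 * m + 9) - l 6)"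
      using antiderivative_has_arc_length[OF z r l] unfolding quintic_curve_period[OF periodic] .
  qed (rule square ph_control_points_exist[OF z] antiderivative_iff_ph_curve[OF z]
      antiderivative_closed[OF z _ _ _ p]; assumption)+
qed

end
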